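(* Let $p,q\in\mathbb{F}[t]$ be monic polynomials of degree $2$. Assume that $p$ is irreducible over $\mathbb{F}$ and that $q(t)=(t-y_1)(t-y_2)$ for scalars $y_1,y_2\in\mathbb{F}$ such that $p(t+y_1)=p(t+y_2)$. Then, for every $(p,q)$-exceptional endomorphism $v$ of a vector space over $\mathbb{F}$, $S(v)$ is a symplectic $(p,q)$-difference.
   Context: $\mathbb{F}$ is an arbitrary field (characteristic $2$ allowed), with a fixed algebraic closure $\overline{\mathbb{F}}$; all vector spaces are finite-dimensional over $\mathbb{F}$. $\operatorname{Root}(r)$ is the set of roots of $r$ in $\overline{\mathbb{F}}$; $\operatorname{Root}(p)-\operatorname{Root}(q):=\{x-y : x\in\operatorname{Root}(p),\,y\in\operatorname{Root}(q)\}$. An endomorphism is $(p,q)$-exceptional if all its eigenvalues in $\overline{\mathbb{F}}$ belong to $\operatorname{Root}(p)-\operatorname{Root}(q)$. A symplectic form is a non-degenerate alternating bilinear form. Given a symplectic form $b$ on $V$, an endomorphism $u$ of $V$ is $b$-alternating if $b(x,u(x))=0$ for all $x\in V$. A symplectic pair $(b,u)$ consists of a symplectic form $b$ on a vector space and a $b$-alternating endomorphism $u$ of it. It is a symplectic $(p,q)$-difference if there are $b$-alternating endomorphisms $u_1,u_2$ with $u=u_1-u_2$, $p(u_1)=0$ and $q(u_2)=0$. For an endomorphism $v$ of $V$ with transpose $v^t:\varphi\mapsto\varphi\circ v$ on the dual space $V^\star$, put $h(v):=v\oplus v^t$ on $V\times V^\star$ and $S_V((x,\varphi),(y,\psi)):=\varphi(y)-\psi(x)$.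 The symplectic extension of $v$ is the symplectic pair $S(v):=(S_V,h(v))$. *)

theory Defs
  imports
    Jordan_Normal_Form.Char_Poly
    "HOL-Algebra.Algebraic_Closure_Type"
    "HOL-Library.Function_Algebras"
    "HOL-Library.Product_Plus"
begin

text \<open>
  The space \<open>V \<times> V\<^sup>*\<close> is a subspace of the type \<open>'v \<times> ('v \<Rightarrow> 'a)\<close> rather than a type,
  so forms and endomorphisms are considered relative to a subspace \<open>W\<close> of a vector space
  type with scalar multiplication \<open>scale\<close>; their values outside \<open>W\<close> are irrelevant.
\<close>

definition fin_dim_space :: "('a::field \<Rightarrow> 'w::ab_group_add \<Rightarrow> 'w) \<Rightarrow> 'w set \<Rightarrow> bool"
  where "fin_dim_space scale W \<longleftrightarrow>
    vector_space scale \<and> (\<exists>B. finite B \<and> module.span scale B = W)"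

definition endo_on :: "('a::field \<Rightarrow> 'w::ab_group_add \<Rightarrow> 'w) \<Rightarrow> 'w set \<Rightarrow> ('w \<Rightarrow> 'w) \<Rightarrow> bool"
  where "endo_on scale W u \<longleftrightarrow>
    (\<forall>x\<in>W. u x \<in> W) \<and>
    (\<forall>x\<in>W. \<forall>y\<in>W. u (x + y) = u x + u y) \<and>
    (\<forall>c. \<forall>x\<in>W. u (scale c x) = scale c (u x))"

definition bilinear_on ::
    "('a::field \<Rightarrow> 'w::ab_group_add \<Rightarrow> 'w) \<Rightarrow> 'w set \<Rightarrow> ('w \<Rightarrow> 'w \<Rightarrow> 'a) \<Rightarrow> bool"
  where "bilinear_on scale W b \<longleftrightarrow>
    (\<forall>x\<in>W. \<forall>y\<in>W. \<forall>z\<in>W. b (x + y) z = b x z + b y z) \<and>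
    (\<forall>x\<in>W. \<forall>y\<in>W. \<forall>z\<in>W. b x (y + z) = b x y + b x z) \<and>
    (\<forall>c. \<forall>x\<in>W. \<forall>y\<in>W. b (scale c x) y = c * b x y) \<and>
    (\<forall>c. \<forall>x\<in>W. \<forall>y\<in>W. b x (scale c y) = c * b x y)"

definition symplectic_form ::
    "('a::field \<Rightarrow> 'w::ab_group_add \<Rightarrow> 'w) \<Rightarrow> 'w set \<Rightarrow> ('w \<Rightarrow> 'w \<Rightarrow> 'a) \<Rightarrow> bool"
  where "symplectic_form scale W b \<longleftrightarrow>
    fin_dim_space scale W \<and> bilinear_on scale W b \<and>
    (\<forall>x\<in>W. b x x = 0) \<and>
    (\<forall>x\<in>W. (\<forall>y\<in>W. b x y = 0) \<longrightarrow> x = 0)"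

definition alternating_endo ::
    "('a::field \<Rightarrow> 'w::ab_group_add \<Rightarrow> 'w) \<Rightarrow> 'w set \<Rightarrow> ('w \<Rightarrow> 'w \<Rightarrow> 'a) \<Rightarrow> ('w \<Rightarrow> 'w) \<Rightarrow> bool"
  where "alternating_endo scale W b u \<longleftrightarrow> endo_on scale W u \<and> (\<forall>x\<in>W. b x (u x) = 0)"

definition symplectic_pair ::
    "('a::field \<Rightarrow> 'w::ab_group_add \<Rightarrow> 'w) \<Rightarrow> 'w set \<Rightarrow> ('w \<Rightarrow> 'w \<Rightarrow> 'a) \<times> ('w \<Rightarrow> 'w) \<Rightarrow> bool"
  where "symplectic_pair scale W = (\<lambda>(b, u).
    symplectic_form scale W b \<and> alternating_endo scale W b u)"

definition poly_endo ::
    "('a::field \<Rightarrow> 'w::ab_group_add \<Rightarrow> 'w) \<Rightarrow> 'a poly \<Rightarrow> ('w \<Rightarrow> 'w) \<Rightarrow> 'w \<Rightarrow> 'w"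
  where "poly_endo scale p u x = (\<Sum>i\<le>Polynomial.degree p. scale (Polynomial.coeff p i) ((u ^^ i) x))"

definition symplectic_difference ::
    "('a::field \<Rightarrow> 'w::ab_group_add \<Rightarrow> 'w) \<Rightarrow> 'w set \<Rightarrow> 'a poly \<Rightarrow> 'a poly \<Rightarrow>
      ('w \<Rightarrow> 'w \<Rightarrow> 'a) \<times> ('w \<Rightarrow> 'w) \<Rightarrow> bool"
  where "symplectic_difference scale W p q = (\<lambda>(b, u).
    symplectic_pair scale W (b, u) \<and>
    (\<exists>u1 u2. alternating_endo scale W b u1 \<and> alternating_endo scale W b u2 \<and>
       (\<forall>x\<in>W. u x = u1 x - u2 x) \<and>
       (\<forall>x\<in>W. poly_endo scale p u1 x = 0) \<and>
       (\<forall>x\<in>W. poly_endo scale q u2 x = 0)))"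

definition dual_space :: "('a::field \<Rightarrow> 'v::ab_group_add \<Rightarrow> 'v) \<Rightarrow> ('v \<Rightarrow> 'a) set"
  where "dual_space scale = {\<phi>. Vector_Spaces.linear scale (*) \<phi>}"

definition ext_scale ::
    "('a::field \<Rightarrow> 'v::ab_group_add \<Rightarrow> 'v) \<Rightarrow> 'a \<Rightarrow> 'v \<times> ('v \<Rightarrow> 'a) \<Rightarrow> 'v \<times> ('v \<Rightarrow> 'a)"
  where "ext_scale scale c = (\<lambda>(x, \<phi>). (scale c x, \<lambda>y. c * \<phi> y))"

definition ext_space :: "('a::field \<Rightarrow> 'v::ab_group_add \<Rightarrow> 'v) \<Rightarrow> ('v \<times> ('v \<Rightarrow> 'a)) set"
  where "ext_space scale = UNIV \<times> dual_space scale"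

definition ext_form :: "'v \<times> ('v \<Rightarrow> 'a::field) \<Rightarrow> 'v \<times> ('v \<Rightarrow> 'a) \<Rightarrow> 'a"
  where "ext_form = (\<lambda>(x, \<phi>) (y, \<psi>). \<phi> y - \<psi> x)"

definition ext_endo :: "('v \<Rightarrow> 'v) \<Rightarrow> 'v \<times> ('v \<Rightarrow> 'a::field) \<Rightarrow> 'v \<times> ('v \<Rightarrow> 'a)"
  where "ext_endo v = (\<lambda>(x, \<phi>). (v x, \<phi> \<circ> v))"

definition symplectic_extension ::
    "('v \<Rightarrow> 'v) \<Rightarrow> ('v \<times> ('v \<Rightarrow> 'a::field) \<Rightarrow> 'v \<times> ('v \<Rightarrow> 'a) \<Rightarrow> 'a) \<times>
      ('v \<times> ('v \<Rightarrow> 'a) \<Rightarrow> 'v \<times> ('v \<Rightarrow> 'a))"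
  where "symplectic_extension v = (ext_form, ext_endo v)"

definition Root :: "'a::field poly \<Rightarrow> 'a alg_closure set"
  where "Root r = {x. poly (map_poly to_ac r) x = 0}"

definition ordered_basis :: "('a::field \<Rightarrow> 'v::ab_group_add \<Rightarrow> 'v) \<Rightarrow> 'v list \<Rightarrow> bool"
  where "ordered_basis scale bs \<longleftrightarrow>
    distinct bs \<and> \<not> module.dependent scale (set bs) \<and> module.span scale (set bs) = UNIV"

definition matrix_of_endo ::
    "('a::field \<Rightarrow> 'v::ab_group_add \<Rightarrow> 'v) \<Rightarrow> 'v list \<Rightarrow> ('v \<Rightarrow> 'v) \<Rightarrow> 'a mat"
  where "matrix_of_endo scale bs v = mat (length bs) (length bs)
    (\<lambda>(i, j). module.representation scale (set bs) (v (bs ! j)) (bs ! i))"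

text \<open>
  An eigenvalue of \<open>v\<close> in the algebraic closure is an eigenvalue of the scalar extension of \<open>v\<close>,
  which has the same matrices as \<open>v\<close>, read over the closure. The choice of the basis
  does not matter, as matrices of \<open>v\<close> in different bases are similar.
\<close>

definition eigenvalue_ac ::
    "('a::field \<Rightarrow> 'v::ab_group_add \<Rightarrow> 'v) \<Rightarrow> ('v \<Rightarrow> 'v) \<Rightarrow> 'a alg_closure \<Rightarrow> bool"
  where "eigenvalue_ac scale v l \<longleftrightarrow>
    (\<exists>bs. ordered_basis scale bs \<and> eigenvalue (map_mat to_ac (matrix_of_endo scale bs v)) l)"

definition exceptional ::
    "('a::field \<Rightarrow> 'v::ab_group_add \<Rightarrow> 'v) \<Rightarrow> 'a poly \<Rightarrow> 'a poly \<Rightarrow> ('v \<Rightarrow> 'v) \<Rightarrow> bool"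
  where "exceptional scale p q v \<longleftrightarrow>
    (\<forall>l. eigenvalue_ac scale v l \<longrightarrow> l \<in> {x - y | x y. x \<in> Root p \<and> y \<in> Root q})"

end

theory Submission
  imports Defs
begin

text \<open>
  Every exceptional \<open>v\<close> is already a difference \<open>u1 - u2\<close> with \<open>p(u1) = 0\<close> and \<open>q(u2) = 0\<close> on \<open>V\<close>
  itself; since \<open>h(u)\<close> is alternating for every \<open>u\<close>, applying \<open>h\<close> gives the result.

  Put \<open>r(t) = p(t + y1) = t\<^sup>2 - l t + m\<close> and \<open>d = y2 - y1\<close>. The hypotheses say that \<open>d = 0\<close>, or
  \<open>d = l\<close> and the characteristic is 2, and exceptionality says that \<open>r(v)\<close> is nilpotent. It
  suffices to write \<open>v = w1 - w2\<close> with \<open>r(w1) = 0\<close> and \<open>w2\<^sup>2 = d w2\<close>.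

  If \<open>d = 0\<close>, let \<open>z = r(v)\<close> and choose a \<open>z\<close>-stable subspace \<open>W\<close> with \<open>V = W \<oplus> v W\<close>. Then
  \<open>w2 (w + v w') = - z w'\<close> works: over \<open>F[z]\<close>, in the decomposition \<open>W \<oplus> v W\<close>, \<open>v\<close> is the companion
  matrix of \<open>r - z\<close> and \<open>w1\<close> that of \<open>r\<close>.

  If \<open>d = l \<noteq> 0\<close>, then \<open>r\<close> is separable and \<open>v = a + b\<close> with \<open>r(a) = 0\<close>, \<open>b\<close> nilpotent, both
  polynomials in \<open>v\<close>. Choose a projection \<open>P\<close> commuting with \<open>a\<close> for which \<open>b\<close> is odd, that is
  \<open>b P = (1 - P) b\<close>; then \<open>w1 = a + l P + b P\<close> and \<open>w2 = l P + b (1 - P)\<close> work.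
\<close>

section \<open>Subspaces adapted to a nilpotent endomorphism\<close>

context vector_space
begin

text \<open>There is a linear projection \<open>g\<close> of the whole space onto \<open>A\<close>;
  its kernel inside \<open>S\<close> is a complement, since \<open>x - g x\<close> stays in
  \<open>S\<close>.\<close>

lemma subspace_complement:
  assumes "subspace A" "subspace S" "A \<subseteq> S"
  obtains C where "subspace C" "C \<subseteq> S" "A \<inter> C = {0}" "\<And>x. x \<in> S \<Longrightarrow> \<exists>a\<in>A. \<exists>c\<in>C. x = a + c"
proof -
  interpret vector_space_pair scale scale by unfold_locales
  obtain g where g: "g ` UNIV \<subseteq> A" "Vector_Spaces.linear scale scale g" "\<forall>v\<in>A. g v = v"
    using linear_exists_left_inverse_on[OF linear_ident, of A] assms(1) by auto
  interpret g: Vector_Spaces.linear scale scale g by fact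
  show thesis
  proof
    show "subspace {x \<in> S. g x = 0}"
      using assms(2) by (auto simp: subspace_def g.zero g.add g.scale)
    show "{x \<in> S. g x = 0} \<subseteq> S" by auto
    show "A \<inter> {x \<in> S. g x = 0} = {0}"
      using g(3) assms subspace_0 g.zero by auto
    fix x assume x: "x \<in> S"
    have "g x \<in> A" using g(1) by auto
    moreover have "x - g x \<in> S"
      using calculation x assms by (auto intro: subspace_diff)
    ultimately show "\<exists>a\<in>A. \<exists>c\<in>{x \<in> S. g x = 0}. x = a + c"
      by (intro bexI[of _ "g x"] bexI[of _ "x - g x"]) (auto simp: g.diff g(3))
  qed
qed

text \<open>A complement of \<open>A + B\<close> in \<open>S\<close>, enlarged by \<open>B\<close>,
  is a complement of \<open>A\<close> that contains \<open>B\<close>.\<close>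

lemma subspace_complement_extend:
  assumes "subspace A" "subspace B" "subspace S" "A \<subseteq> S" "B \<subseteq> S" "A \<inter> B = {0}"
  obtains C where "subspace C" "B \<subseteq> C" "C \<subseteq> S" "A \<inter> C = {0}" "\<And>x. x \<in> S \<Longrightarrow> \<exists>a\<in>A. \<exists>c\<in>C. x = a + c"
proof -
  define M where "M = {a + b | a b. a \<in> A \<and> b \<in> B}"
  have M: "subspace M" "M \<subseteq> S"
    unfolding M_def using assms by (auto intro: subspace_sums subspace_add)
  obtain D where D: "subspace D" "D \<subseteq> S" "M \<inter> D = {0}" "\<And>x. x \<in> S \<Longrightarrow> \<exists>m\<in>M. \<exists>d\<in>D. x = m + d"
    using subspace_complement[OF M(1) assms(3) M(2)] by blast
  show thesis
  proof
    let ?C = "{b + d | b d. b \<in> B \<and> d \<in> D}"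
    show "subspace ?C" using assms D by (auto intro: subspace_sums)
    show "B \<subseteq> ?C" using subspace_0[OF D(1)] by force
    show "?C \<subseteq> S" using assms D by (auto intro: subspace_add)
    have "x = 0" if "x \<in> A" "x = b + d" "b \<in> B" "d \<in> D" for x b d
    proof -
      have "d = x + (- b)" using that by simp
      then have "d \<in> M" unfolding M_def using that assms subspace_neg by blast
      then have "d = 0" using that D by auto
      then show ?thesis using that assms(6) by auto
    qed
    then show "A \<inter> ?C = {0}"
      using subspace_0[OF assms(1)] subspace_0[OF assms(2)] subspace_0[OF D(1)] by force
    fix x assume "x \<in> S"
    then obtain m d where "m \<in> M" "d \<in> D" "x = m + d" using D(4) by blast
    then obtain a b where "a \<in> A" "b \<in> B" "x = a + (b + d)" by (auto simp: M_def add.assoc)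
    with \<open>d \<in> D\<close> show "\<exists>a\<in>A. \<exists>c\<in>?C. x = a + c" by blast
  qed
qed

text \<open>\<open>A\<close> and \<open>B\<close> need not span the space, so \<open>B\<close> is
  first enlarged to a full complement \<open>C\<close> of \<open>A\<close>; \<pi> is then the
  projection onto \<open>A\<close> along \<open>C\<close>.\<close>

lemma projection_exists:
  assumes "subspace A" "subspace B" "A \<inter> B = {0}"
  obtains \<pi> where "Vector_Spaces.linear scale scale \<pi>" "\<And>a. a \<in> A \<Longrightarrow> \<pi> a = a" "\<And>b. b \<in> B \<Longrightarrow> \<pi> b = 0"
proof -
  obtain C where C: "subspace C" "B \<subseteq> C" "A \<inter> C = {0}" "\<And>x. \<exists>a\<in>A. \<exists>c\<in>C. x = a + c"
    using subspace_complement_extend[OF assms(1,2) subspace_UNIV _ _ assms(3)] by auto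
  define \<pi> where "\<pi> x = (THE a. a \<in> A \<and> x - a \<in> C)" for x
  have eq: "\<pi> x = a" if "a \<in> A" "x - a \<in> C" for x a
    unfolding \<pi>_def
  proof (rule the_equality)
    fix b assume b: "b \<in> A \<and> x - b \<in> C"
    have "(x - a) - (x - b) \<in> C" using b that subspace_diff[OF C(1)] by blast
    then have "b - a \<in> C" by simp
    moreover have "b - a \<in> A" using b that by (intro subspace_diff[OF assms(1)]) auto
    ultimately have "b - a \<in> A \<inter> C" by blast
    then show "b = a" using C(3) by simp
  qed (use that in auto)
  have p: "\<pi> x \<in> A" "x - \<pi> x \<in> C" for x
  proof -
    obtain a c where "a \<in> A" "c \<in> C" "x = a + c" using C(4) by blast
    moreover from this have "\<pi> x = a" by (intro eq) auto
    ultimately show "\<pi> x \<in> A" "x - \<pi> x \<in> C" by auto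
  qed
  show thesis
  proof
    show "Vector_Spaces.linear scale scale \<pi>"
    proof unfold_locales
      fix x y :: 'b and c :: 'a
      show "\<pi> (x + y) = \<pi> x + \<pi> y"
      proof (rule eq)
        show "\<pi> x + \<pi> y \<in> A" using p assms(1) by (auto intro: subspace_add)
        have "(x - \<pi> x) + (y - \<pi> y) \<in> C" using p C(1) by (auto intro: subspace_add)
        then show "x + y - (\<pi> x + \<pi> y) \<in> C" by (simp add: algebra_simps)
      qed
      show "\<pi> (scale c x) = scale c (\<pi> x)"
      proof (rule eq)
        show "scale c (\<pi> x) \<in> A" using p assms(1) by (auto intro: subspace_scale)
        have "scale c (x - \<pi> x) \<in> C" using p C(1) by (auto intro: subspace_scale)
        then show "scale c x - scale c (\<pi> x) \<in> C" by (simp add: scale_right_diff_distrib)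
      qed
    qed
    show "\<pi> a = a" if "a \<in> A" for a using that subspace_0[OF C(1)] by (intro eq) auto
    show "\<pi> b = 0" if "b \<in> B" for b using that C(2) subspace_0[OF assms(1)] by (intro eq) auto
  qed
qed

text \<open>This drives the induction step of both constructions below: a piece \<open>Y\<close> of
  the image is lifted to a subspace with prescribed kernel \<open>K\<close>. With \<open>U\<close>
  the preimage of \<open>Y\<close> in \<open>S\<close>, \<open>N\<close> the kernel in
  \<open>S\<close>, and \<open>C\<close> a complement of \<open>A' + N\<close> in \<open>U\<close>,
  the sum \<open>A' + K + C\<close> works: \<open>C\<close> supplies the missing values without new
  kernel vectors.\<close>

lemma subspace_lift:
  assumes "Vector_Spaces.linear scale scale z"
    and "subspace S" "subspace A'" "subspace K" "subspace Y"
    and "A' \<subseteq> S" "K \<subseteq> S" "Y \<subseteq> z ` S" "z ` A' \<subseteq> Y"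
    and "\<And>x. x \<in> K \<Longrightarrow> z x = 0" "\<And>x. x \<in> A' \<Longrightarrow> z x = 0 \<Longrightarrow> x \<in> K"
  obtains A where "subspace A" "A' \<subseteq> A" "K \<subseteq> A" "A \<subseteq> S" "z ` A = Y"
    "\<And>x. x \<in> A \<Longrightarrow> z x = 0 \<Longrightarrow> x \<in> K"
proof -
  interpret z: Vector_Spaces.linear scale scale z by fact
  define N where "N = {x \<in> S. z x = 0}"
  define U where "U = {x \<in> S. z x \<in> Y}"
  define M where "M = {a + n | a n. a \<in> A' \<and> n \<in> N}"
  have N: "subspace N" and U: "subspace U"
    using assms(2,5) by (auto simp: subspace_def N_def U_def z.zero z.add z.scale)
  have M: "subspace M" unfolding M_def using assms N by (auto intro: subspace_sums)
  have MU: "M \<subseteq> U" using assms(2,6,9) subspace_0[OF assms(5)]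
    by (auto simp: M_def U_def N_def z.add intro: subspace_add)
  obtain C where C: "subspace C" "C \<subseteq> U" "M \<inter> C = {0}" "\<And>x. x \<in> U \<Longrightarrow> \<exists>m\<in>M. \<exists>c\<in>C. x = m + c"
    using subspace_complement[OF M U MU] by blast
  let ?A1 = "{a + k | a k. a \<in> A' \<and> k \<in> K}"
  let ?A = "{a + c | a c. a \<in> ?A1 \<and> c \<in> C}"
  have zero: "0 \<in> A'" "0 \<in> K" "0 \<in> C" using assms C by (auto intro: subspace_0)
  have sub1: "subspace ?A1" using assms by (auto intro: subspace_sums)
  show thesis
  proof
    show "subspace ?A" by (rule subspace_sums[OF sub1 C(1)])
    show "A' \<subseteq> ?A" using zero by force
    show "K \<subseteq> ?A"
    proof
      fix k assume "k \<in> K"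
      then have "0 + k \<in> ?A1" using zero by blast
      then have "(0 + k) + 0 \<in> ?A" using zero by blast
      then show "k \<in> ?A" by simp
    qed
    show "?A \<subseteq> S"
    proof clarify
      fix a k c assume "a \<in> A'" "k \<in> K" "c \<in> C"
      then have "a \<in> S" "k \<in> S" "c \<in> S" using assms C(2) by (auto simp: U_def)
      then show "a + k + c \<in> S" using assms(2) by (auto intro: subspace_add)
    qed
    show "z ` ?A = Y"
    proof (intro equalityI subsetI)
      fix y assume "y \<in> z ` ?A"
      then obtain a k c where "a \<in> A'" "k \<in> K" "c \<in> C" "y = z (a + k + c)" by auto
      then have "y = z a + z c" "z a \<in> Y" "z c \<in> Y"
        using assms C(2) by (auto simp: z.add U_def)
      then show "y \<in> Y" using assms(5) by (auto intro: subspace_add)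
    next
      fix y assume "y \<in> Y"
      then obtain x where x: "x \<in> U" "y = z x" using assms(8) by (auto simp: U_def)
      obtain a n c where "a \<in> A'" "n \<in> N" "c \<in> C" "x = a + n + c"
        using C(4)[OF x(1)] by (auto simp: M_def)
      moreover from this have "(a + 0) + c \<in> ?A" using zero by blast
      ultimately show "y \<in> z ` ?A"
        using x(2) by (intro image_eqI[of _ _ "(a + 0) + c"]) (simp_all add: z.add N_def)
    qed
    fix x assume "x \<in> ?A" "z x = 0"
    then obtain a k c where x: "a \<in> A'" "k \<in> K" "c \<in> C" "x = a + k + c" by auto
    have "x \<in> S" using \<open>x \<in> ?A\<close> \<open>?A \<subseteq> S\<close> by blast
    with \<open>z x = 0\<close> have "x \<in> N" by (simp add: N_def)
    moreover have "k \<in> N" using x assms by (auto simp: N_def)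
    ultimately have "x - k \<in> N" using N by (auto intro: subspace_diff)
    then have "- a + (x - k) \<in> M" unfolding M_def using x(1) assms(3) subspace_neg by blast
    then have "c \<in> M" using x(4) by simp
    then have "c = 0" using x(3) C(3) by auto
    then have "z a = 0" using \<open>z x = 0\<close> x assms(10) by (simp add: z.add)
    then have "a \<in> K" using x assms(11) by auto
    then show "x \<in> K" using x \<open>c = 0\<close> assms(4) by (auto intro: subspace_add)
  qed
qed

text \<open>
  A decomposition of the image of \<open>z\<close> is lifted to the whole space after extending its trace on the
  kernel; this replaces the cyclic decomposition, here and in \<open>nilpotent_split\<close> below.
\<close>
lemma nilpotent_grading:
  assumes "Vector_Spaces.linear scale scale z" "subspace S" "z ` S \<subseteq> S" "\<And>x. x \<in> S \<Longrightarrow> (z ^^ n) x = 0"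
  shows "\<exists>A B. subspace A \<and> subspace B \<and> A \<subseteq> S \<and> B \<subseteq> S \<and> A \<inter> B = {0} \<and>
    (\<forall>x\<in>S. \<exists>a\<in>A. \<exists>b\<in>B. x = a + b) \<and> z ` A \<subseteq> B \<and> z ` B \<subseteq> A"
  using assms(2-4)
proof (induction n arbitrary: S)
  case 0
  interpret z: Vector_Spaces.linear scale scale z by fact
  show ?case using 0 by (intro exI[of _ "{0}"]) (auto simp: subspace_0 z.zero)
next
  case (Suc n)
  interpret z: Vector_Spaces.linear scale scale z by fact
  have sub: "subspace (z ` S)" using Suc.prems by (auto intro: z.subspace_image)
  have st: "z ` (z ` S) \<subseteq> z ` S" using Suc.prems by auto
  have nil: "(z ^^ n) x = 0" if "x \<in> z ` S" for x
    using that Suc.prems(3) by (auto simp: funpow_swap1)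
  from Suc.IH[OF sub st nil] obtain A B
    where AB: "subspace A" "subspace B" "A \<subseteq> z ` S" "B \<subseteq> z ` S" "A \<inter> B = {0}"
      "\<And>x. x \<in> z ` S \<Longrightarrow> \<exists>a\<in>A. \<exists>b\<in>B. x = a + b" "z ` A \<subseteq> B" "z ` B \<subseteq> A" by metis
  define K where "K = {x \<in> S. z x = 0}"
  have K: "subspace K" using Suc.prems(1) by (auto simp: subspace_def K_def z.zero z.add z.scale)
  have BK: "subspace (B \<inter> K)" "subspace (A \<inter> K)" using AB K by (auto intro: subspace_inter)
  have int0: "(B \<inter> K) \<inter> (A \<inter> K) = {0}" using AB(5) subspace_0[OF K] by auto
  \<comment> \<open>The kernel is shared out between the two lifts: one receives
    \<open>B \<inter> K\<close>, the other a complement of it that contains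
    \<open>A \<inter> K\<close>.\<close>
  obtain KA where KA: "subspace KA" "A \<inter> K \<subseteq> KA" "KA \<subseteq> K" "(B \<inter> K) \<inter> KA = {0}"
     "\<And>x. x \<in> K \<Longrightarrow> \<exists>b\<in>B \<inter> K. \<exists>a\<in>KA. x = b + a"
    by (rule subspace_complement_extend[OF BK K _ _ int0]) auto
  have AS: "A \<subseteq> S" "B \<subseteq> S" using AB Suc.prems by auto
  have A_lift: "KA \<subseteq> S" "\<And>x. x \<in> KA \<Longrightarrow> z x = 0" "\<And>x. x \<in> A \<Longrightarrow> z x = 0 \<Longrightarrow> x \<in> KA"
    using KA(2,3) AS by (auto simp: K_def)
  \<comment> \<open>The lifts are crossed because \<open>z\<close> must exchange the two parts:
    \<open>A1\<close> contains \<open>A\<close> but lies over \<open>B\<close>, and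
    \<open>B1\<close> contains \<open>B\<close> but lies over \<open>A\<close>.\<close>
  from subspace_lift[OF assms(1) Suc.prems(1) AB(1) KA(1) AB(2) AS(1) A_lift(1) AB(4,7) A_lift(2,3)]
  obtain A1 where A1: "subspace A1" "A \<subseteq> A1" "KA \<subseteq> A1" "A1 \<subseteq> S" "z ` A1 = B"
    "\<And>x. x \<in> A1 \<Longrightarrow> z x = 0 \<Longrightarrow> x \<in> KA" by metis
  have B_lift: "B \<inter> K \<subseteq> S" "\<And>x. x \<in> B \<inter> K \<Longrightarrow> z x = 0" "\<And>x. x \<in> B \<Longrightarrow> z x = 0 \<Longrightarrow> x \<in> B \<inter> K"
    using AS by (auto simp: K_def)
  from subspace_lift[OF assms(1) Suc.prems(1) AB(2) BK(1) AB(1) AS(2) B_lift(1) AB(3,8) B_lift(2,3)]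
  obtain B1 where B1: "subspace B1" "B \<subseteq> B1" "B \<inter> K \<subseteq> B1" "B1 \<subseteq> S" "z ` B1 = A"
    "\<And>x. x \<in> B1 \<Longrightarrow> z x = 0 \<Longrightarrow> x \<in> B \<inter> K" by metis
  \<comment> \<open>\<open>z x\<close> lies in both \<open>A\<close> and \<open>B\<close>, so it
    vanishes; then \<open>x\<close> lies in both shares of the kernel.\<close>
  have "x = 0" if "x \<in> A1" "x \<in> B1" for x
  proof -
    have "z x \<in> A \<inter> B" using that A1 B1 by blast
    then have "z x = 0" using AB(5) by auto
    then have "x \<in> (B \<inter> K) \<inter> KA" using that A1(6) B1(6) by blast
    then show ?thesis using KA(4) by auto
  qed
  then have int: "A1 \<inter> B1 = {0}" using subspace_0[OF A1(1)] subspace_0[OF B1(1)] by auto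
  have "\<exists>a\<in>A1. \<exists>b\<in>B1. x = a + b" if x: "x \<in> S" for x
  proof -
    obtain a' b' where "a' \<in> A" "b' \<in> B" "z x = a' + b'" using AB(6) x by blast
    then obtain a b where ab: "a \<in> A1" "b \<in> B1" "z x = z b + z a"
      using A1(5) B1(5) by (metis imageE add.commute)
    then have "a \<in> S" "b \<in> S" using A1 B1 by auto
    then have "x - (a + b) \<in> K"
      using ab x Suc.prems(1) by (auto simp: K_def z.diff z.add intro!: subspace_diff subspace_add)
    then obtain b2 a2 where "b2 \<in> B \<inter> K" "a2 \<in> KA" "x - (a + b) = b2 + a2" using KA(5) by blast
    then have "a + a2 \<in> A1" "b + b2 \<in> B1" "x = (a + a2) + (b + b2)"
      using ab A1 B1 by (auto simp: algebra_simps intro: subspace_add)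
    then show ?thesis by blast
  qed
  moreover have "z ` A1 \<subseteq> B1" "z ` B1 \<subseteq> A1" using A1(2,5) B1(2,5) by simp_all
  ultimately show ?case using A1(1,4) B1(1,4) int by (intro exI[of _ A1] exI[of _ B1] conjI ballI)
qed

end

section \<open>Subspaces that span freely over a quadratic extension\<close>

context finite_dimensional_vector_space
begin

text \<open>
  The condition on \<open>w\<close> and \<open>s w\<close> says that the sum \<open>W + s W\<close> is direct; as \<open>s\<close> makes \<open>K\<close> a vector
  space over the quadratic extension, it says that \<open>W\<close> spans freely over that extension.
\<close>
lemma split_subspace_extend:
  assumes "Vector_Spaces.linear scale scale s"
    and K: "subspace K" "s ` K \<subseteq> K"
    and quad: "\<And>x. x \<in> K \<Longrightarrow> s (s x) = scale l (s x) - scale m x"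
    and irr: "\<And>e. e * e - l * e + m \<noteq> 0"
    and K0: "subspace K0" "K0 \<subseteq> K" "\<And>w. w \<in> K0 \<Longrightarrow> s w \<in> K0 \<Longrightarrow> w = 0"
  obtains K1 where "subspace K1" "K0 \<subseteq> K1" "K1 \<subseteq> K" "\<And>w. w \<in> K1 \<Longrightarrow> s w \<in> K1 \<Longrightarrow> w = 0"
    "\<And>x. x \<in> K \<Longrightarrow> \<exists>w\<in>K1. \<exists>w'\<in>K1. x = w + s w'"
proof -
  interpret s: Vector_Spaces.linear scale scale s by fact
  define good where "good W \<longleftrightarrow> subspace W \<and> K0 \<subseteq> W \<and> W \<subseteq> K \<and> (\<forall>w\<in>W. s w \<in> W \<longrightarrow> w = 0)" for W
  have "good K0" using K0 by (auto simp: good_def)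
  \<comment> \<open>Dimensions are bounded, so a good subspace of largest dimension exists; if
    \<open>W + s W\<close> missed a vector of \<open>K\<close>, that vector could be adjoined to
    \<open>W\<close>.\<close>
  then obtain W where W: "good W" and max: "\<And>W'. good W' \<Longrightarrow> dim W' \<le> dim W"
    using ex_has_greatest_nat[of good K0 dim "Suc dimension"] dim_subset_UNIV by (metis le_imp_less_Suc)
  have sW: "subspace W" "W \<subseteq> K" "K0 \<subseteq> W" and W0: "\<And>w. w \<in> W \<Longrightarrow> s w \<in> W \<Longrightarrow> w = 0"
    using W by (auto simp: good_def)
  define M where "M = {w + w' | w w'. w \<in> W \<and> w' \<in> s ` W}"
  have M: "subspace M" unfolding M_def using sW by (auto intro!: subspace_sums s.subspace_image)
  have WM: "W \<subseteq> M" "s ` W \<subseteq> M"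
    unfolding M_def using subspace_0[OF sW(1)] s.zero by force+
  have sM: "s x \<in> M" if "x \<in> M" for x
  proof -
    obtain w w' where w: "w \<in> W" "w' \<in> W" "x = w + s w'" using \<open>x \<in> M\<close> unfolding M_def by blast
    then have "s x = (scale l (s w') - scale m w') + s w"
      using quad[of w'] sW by (auto simp: s.add add.commute)
    also have "\<dots> \<in> M" using w WM
      by (intro subspace_add[OF M] subspace_diff[OF M] subspace_scale[OF M]) auto
    finally show ?thesis .
  qed
  have KM: "K \<subseteq> M"
  proof (rule ccontr)
    assume "\<not> K \<subseteq> M"
    then obtain y where y: "y \<in> K" "y \<notin> M" by auto
    define W' where "W' = span (insert y W)"
    have W'_iff: "x \<in> W' \<longleftrightarrow> (\<exists>k. x - scale k y \<in> W)" for x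
      unfolding W'_def span_breakdown_eq using span_eq_iff sW(1) by metis
    have no: "scale c y \<notin> M" if "c \<noteq> 0" for c
      using subspace_scale[OF M, of "scale c y" "inverse c"] that y by auto
    \<comment> \<open>Modulo \<open>M\<close>, \<open>y\<close> is not an eigenvector of
      \<open>s\<close>: applying \<open>s - (l - e)\<close> to \<open>s y - e y\<close> leaves a
      multiple of \<open>y\<close>, whose factor is non-zero because the quadratic has no root
      \<open>e\<close>.\<close>
    have sy: "s y - scale e y \<notin> M" for e
    proof
      assume "s y - scale e y \<in> M"
      then have "s (s y - scale e y) - scale (l - e) (s y - scale e y) \<in> M"
        using sM M by (auto intro: subspace_diff subspace_scale)
      also have "s (s y - scale e y) - scale (l - e) (s y - scale e y) = scale (- (e * e - l * e + m)) y"
        by (simp add: s.diff s.scale quad[OF y(1)] algebra_simps)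
      finally show False using no[of "- (e * e - l * e + m)"] irr[of e] by (simp only: neg_equal_0_iff_equal simp_thms)
    qed
    have "good W'"
      unfolding good_def
    proof (intro conjI ballI impI)
      show "subspace W'" by (simp add: W'_def)
      show "K0 \<subseteq> W'" using sW span_superset by (force simp: W'_def)
      show "W' \<subseteq> K" unfolding W'_def using sW y K by (intro span_minimal) auto
      fix w assume "w \<in> W'" "s w \<in> W'"
      then obtain k k' where k: "w - scale k y \<in> W" "s w - scale k' y \<in> W" by (auto simp: W'_iff)
      then have "s (w - scale k y) \<in> M" "s w - scale k' y \<in> M" using WM by auto
      then have mem: "(s w - scale k' y) - s (w - scale k y) \<in> M"
        using M by (auto intro: subspace_diff)
      have eq: "(s w - scale k' y) - s (w - scale k y) = scale k (s y) - scale k' y"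
        by (simp add: s.diff s.scale)
      \<comment> \<open>Otherwise division by \<open>k\<close> would put
        \<open>s y - (k' / k) y\<close> into \<open>M\<close>.\<close>
      have "k = 0"
      proof (rule ccontr)
        assume "k \<noteq> 0"
        have "scale (inverse k) (scale k (s y) - scale k' y) \<in> M"
          using mem eq M by (auto intro: subspace_scale)
        then show False using sy[of "inverse k * k'"] \<open>k \<noteq> 0\<close> by (simp add: scale_right_diff_distrib)
      qed
      moreover from this have "k' = 0"
        using mem eq no[of "- k'"] by auto
      ultimately show "w = 0" using k W0[of w] by simp
    qed
    then have "subspace W'" "dim W' \<le> dim W" by (auto intro: max simp: good_def)
    moreover have "W \<subseteq> W'" unfolding W'_def by (meson span_superset subset_insertI subset_trans)
    ultimately have "W = W'" using sW(1) by (intro subspace_dim_equal)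
    moreover have "y \<in> W'" by (simp add: W'_def span_base)
    ultimately have "y \<in> W" by simp
    then show False using y WM by auto
  qed
  show thesis
  proof (rule that[OF sW(1,3,2) W0])
    fix x assume "x \<in> K"
    then have "x \<in> M" using KM by blast
    then show "\<exists>w\<in>W. \<exists>w'\<in>W. x = w + s w'" unfolding M_def by blast
  qed
qed

text \<open>The quadratic relation makes the kernel of \<open>z\<close> a vector space over a
  quadratic extension field, so a suitable subspace exists there; the rest is lifted from the image
  of \<open>z\<close>. The relation is required on the kernel only, which admits
  \<open>s = v\<close>, \<open>z = r(v)\<close> as well as \<open>s = a\<close>,
  \<open>z = b\<close> with \<open>r(a) = 0\<close>.\<close>

lemma nilpotent_split:
  assumes "Vector_Spaces.linear scale scale s" "Vector_Spaces.linear scale scale z"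
    and comm: "\<And>x. s (z x) = z (s x)"
    and irr: "\<And>e. e * e - l * e + m \<noteq> 0"
    and "subspace S" "s ` S \<subseteq> S" "z ` S \<subseteq> S" "\<And>x. x \<in> S \<Longrightarrow> (z ^^ n) x = 0"
    and "\<And>x. x \<in> S \<Longrightarrow> z x = 0 \<Longrightarrow> s (s x) = scale l (s x) - scale m x"
  shows "\<exists>W. subspace W \<and> W \<subseteq> S \<and> z ` W \<subseteq> W \<and> (\<forall>w\<in>W. s w \<in> W \<longrightarrow> w = 0) \<and>
    (\<forall>x\<in>S. \<exists>w\<in>W. \<exists>w'\<in>W. x = w + s w')"
  using assms(5-)
proof (induction n arbitrary: S)
  case 0
  interpret s: Vector_Spaces.linear scale scale s by fact
  interpret z: Vector_Spaces.linear scale scale z by fact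
  show ?case using 0 by (intro exI[of _ "{0}"]) (auto simp: subspace_0 z.zero s.zero)
next
  case (Suc n)
  interpret s: Vector_Spaces.linear scale scale s by fact
  interpret z: Vector_Spaces.linear scale scale z by fact
  have sub: "subspace (z ` S)" using Suc.prems by (auto intro: z.subspace_image)
  have st: "z ` (z ` S) \<subseteq> z ` S" "s ` (z ` S) \<subseteq> z ` S" using Suc.prems by (auto simp: comm)
  have nil: "(z ^^ n) x = 0" if "x \<in> z ` S" for x
    using that Suc.prems(4) by (auto simp: funpow_swap1)
  have "s (s x) = scale l (s x) - scale m x" if "x \<in> z ` S" "z x = 0" for x
    using that Suc.prems by blast
  from Suc.IH[OF sub st(2,1) nil this] obtain W'
    where W': "subspace W'" "W' \<subseteq> z ` S" "z ` W' \<subseteq> W'" "\<And>w. w \<in> W' \<Longrightarrow> s w \<in> W' \<Longrightarrow> w = 0"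
      "\<And>x. x \<in> z ` S \<Longrightarrow> \<exists>w\<in>W'. \<exists>w'\<in>W'. x = w + s w'" by metis
  define K where "K = {x \<in> S. z x = 0}"
  have K: "subspace K" using Suc.prems(1) by (auto simp: subspace_def K_def z.zero z.add z.scale)
  have sK: "s ` K \<subseteq> K" using Suc.prems(2) comm[symmetric] by (auto simp: K_def s.zero)
  have quadK: "s (s x) = scale l (s x) - scale m x" if "x \<in> K" for x
    using that Suc.prems(5) by (auto simp: K_def)
  have WK: "subspace (W' \<inter> K)" "W' \<inter> K \<subseteq> K" using W' K by (auto intro: subspace_inter)
  have "w = 0" if "w \<in> W' \<inter> K" "s w \<in> W' \<inter> K" for w using that W'(4) by auto
  from split_subspace_extend[OF assms(1) K sK quadK irr WK this]
  obtain K1 where K1: "subspace K1" "W' \<inter> K \<subseteq> K1" "K1 \<subseteq> K" "\<And>w. w \<in> K1 \<Longrightarrow> s w \<in> K1 \<Longrightarrow> w = 0"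
    "\<And>x. x \<in> K \<Longrightarrow> \<exists>w\<in>K1. \<exists>w'\<in>K1. x = w + s w'" by metis
  have W'S: "W' \<subseteq> S" using W' Suc.prems by auto
  have "K1 \<subseteq> S" "\<And>x. x \<in> K1 \<Longrightarrow> z x = 0" "\<And>x. x \<in> W' \<Longrightarrow> z x = 0 \<Longrightarrow> x \<in> K1"
    using K1 W'S by (auto simp: K_def)
  \<comment> \<open>\<open>W'\<close> is lifted over itself: then \<open>z W = W'\<close> is
    contained in \<open>W\<close>, which gives stability under \<open>z\<close>.\<close>
  from subspace_lift[OF assms(2) Suc.prems(1) W'(1) K1(1) W'(1) W'S this(1) W'(2,3) this(2,3)]
  obtain W where W: "subspace W" "W' \<subseteq> W" "K1 \<subseteq> W" "W \<subseteq> S" "z ` W = W'"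
    "\<And>x. x \<in> W \<Longrightarrow> z x = 0 \<Longrightarrow> x \<in> K1" by metis
  \<comment> \<open>The property of \<open>W'\<close> gives \<open>z w = 0\<close>; then
    \<open>w\<close> and \<open>s w\<close> both lie in \<open>K1\<close>, which has the same
    property.\<close>
  have "w = 0" if w: "w \<in> W" "s w \<in> W" for w
  proof -
    have "z w \<in> W'" "s (z w) \<in> W'" using w W(5) comm by auto
    then have "z w = 0" by (rule W'(4))
    moreover from this have "z (s w) = 0" using comm[of w] by (simp add: s.zero)
    ultimately show ?thesis using w W(6) K1(4) by blast
  qed
  moreover have "\<exists>w\<in>W. \<exists>w'\<in>W. x = w + s w'" if x: "x \<in> S" for x
  proof -
    obtain a b where "a \<in> W" "b \<in> W" "z x = z a + s (z b)"
      using W'(5)[of "z x"] x W(5) by (metis (no_types, lifting) imageE imageI)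
    moreover from this have "a \<in> S" "b \<in> S" using W by auto
    ultimately have ab: "a \<in> W" "b \<in> W" "x - (a + s b) \<in> K"
      using x Suc.prems(1,2) by (auto simp: K_def z.diff z.add comm intro!: subspace_diff subspace_add)
    then obtain c d where "c \<in> K1" "d \<in> K1" "x - (a + s b) = c + s d" using K1(5) by metis
    then have "a + c \<in> W" "b + d \<in> W" "x = (a + c) + s (b + d)"
      using ab W by (auto simp: algebra_simps s.add intro: subspace_add)
    then show ?thesis by blast
  qed
  moreover have "z ` W \<subseteq> W" using W(2,5) by simp
  ultimately show ?case using W(1,4) by (intro exI[of _ W] conjI ballI impI)
qed

end

section \<open>Polynomials in an endomorphism\<close>

context vector_space
begin

lemma poly_endo_sum:
  assumes "Polynomial.degree p \<le> n"
  shows "poly_endo scale p u x = (\<Sum>i\<le>n. scale (Polynomial.coeff p i) ((u ^^ i) x))"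
  unfolding poly_endo_def using assms
  by (intro sum.mono_neutral_left) (auto simp: coeff_eq_0)

lemma poly_endo_0 [simp]: "poly_endo scale 0 u x = 0"
  by (simp add: poly_endo_def)

lemma poly_endo_smult: "poly_endo scale (Polynomial.smult c p) u x = scale c (poly_endo scale p u x)"
  by (simp add: poly_endo_sum[OF order.refl, of p] poly_endo_sum[of "Polynomial.smult c p" "Polynomial.degree p"]
      scale_sum_right)

lemma poly_endo_add: "poly_endo scale (p + q) u x = poly_endo scale p u x + poly_endo scale q u x"
proof -
  let ?n = "max (Polynomial.degree p) (Polynomial.degree q)"
  have "Polynomial.degree (p + q) \<le> ?n" by (simp add: degree_add_le_max)
  then show ?thesis
    by (simp add: poly_endo_sum[of _ ?n] scale_left_distrib sum.distrib)
qed

lemma poly_endo_diff: "poly_endo scale (p - q) u x = poly_endo scale p u x - poly_endo scale q u x"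
  using poly_endo_add[of "p - q" q u x] by simp

context
  fixes u
  assumes u: "Vector_Spaces.linear scale scale u"
begin

interpretation u: Vector_Spaces.linear scale scale u by (rule u)

text \<open>The Horner step on which the inductions over polynomials below rest.\<close>

lemma poly_endo_pCons: "poly_endo scale (pCons a p) u x = scale a x + u (poly_endo scale p u x)"
proof -
  have "poly_endo scale (pCons a p) u x
      = (\<Sum>i\<le>Suc (Polynomial.degree p). scale (Polynomial.coeff (pCons a p) i) ((u ^^ i) x))"
    by (intro poly_endo_sum) (simp add: degree_pCons_le)
  also have "\<dots> = scale a x + u (poly_endo scale p u x)"
    by (simp add: sum.atMost_Suc_shift poly_endo_def u.sum u.scale del: sum.atMost_Suc)
  finally show ?thesis .
qed

lemma linear_poly_endo: "Vector_Spaces.linear scale scale (poly_endo scale p u)"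
proof (induction p)
  case 0
  then show ?case by unfold_locales simp_all
next
  case (pCons a p)
  interpret p: Vector_Spaces.linear scale scale "poly_endo scale p u" by (rule pCons.IH)
  show ?case
    by unfold_locales
      (simp_all add: poly_endo_pCons u.add p.add u.scale p.scale scale_right_distrib mult.commute)
qed

lemma poly_endo_commute: "poly_endo scale p u (u x) = u (poly_endo scale p u x)"
  by (induction p) (simp_all add: poly_endo_pCons u.zero u.add u.scale)

lemma poly_endo_mult: "poly_endo scale (p * q) u x = poly_endo scale p u (poly_endo scale q u x)"
  by (induction p) (simp_all add: poly_endo_pCons poly_endo_add poly_endo_smult)

lemma poly_endo_power: "poly_endo scale (p ^ n) u x = (poly_endo scale p u ^^ n) x"
  by (induction n arbitrary: x) (simp_all add: poly_endo_mult one_pCons poly_endo_pCons u.zero)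

end

text \<open>\<open>Q\<close> reads the coordinate \<open>w'\<close> off \<open>w + s w'\<close>. The
  hypothesis makes \<open>s\<close> injective on \<open>W\<close> and \<open>s W \<inter> W\<close>
  trivial, so a projection that fixes \<open>s W\<close> and kills \<open>W\<close>, followed by a
  left inverse of \<open>s\<close> on \<open>W\<close>, does this.\<close>

lemma split_coordinate:
  assumes "Vector_Spaces.linear scale scale s" "subspace W" "\<And>w. w \<in> W \<Longrightarrow> s w \<in> W \<Longrightarrow> w = 0"
  obtains Q where "Vector_Spaces.linear scale scale Q" "\<And>w. w \<in> W \<Longrightarrow> Q w = 0" "\<And>w. w \<in> W \<Longrightarrow> Q (s w) = w"
proof -
  interpret vector_space_pair scale scale by unfold_locales
  interpret s: Vector_Spaces.linear scale scale s by fact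
  have "inj_on s W"
  proof (rule inj_onI)
    fix a b assume "a \<in> W" "b \<in> W" "s a = s b"
    then have "a - b \<in> W" "s (a - b) \<in> W" using assms(2) by (auto simp: s.diff subspace_0 intro: subspace_diff)
    then have "a - b = 0" by (rule assms(3))
    then show "a = b" by simp
  qed
  then obtain g where g: "Vector_Spaces.linear scale scale g" "\<forall>w\<in>W. g (s w) = w"
    using linear_exists_left_inverse_on[OF assms(1,2)] by blast
  have sub: "subspace (s ` W)" using assms(2) by (rule s.subspace_image)
  have "s ` W \<inter> W \<subseteq> {0}" using assms(3) s.zero by blast
  then have "s ` W \<inter> W = {0}" using subspace_0[OF assms(2)] subspace_0[OF sub] by blast
  then obtain \<pi> where \<pi>: "Vector_Spaces.linear scale scale \<pi>" "\<And>a. a \<in> s ` W \<Longrightarrow> \<pi> a = a" "\<And>b. b \<in> W \<Longrightarrow> \<pi> b = 0"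
    using projection_exists[OF sub assms(2)] by metis
  interpret g: Vector_Spaces.linear scale scale g by fact
  interpret \<pi>: Vector_Spaces.linear scale scale \<pi> by fact
  show thesis
    by (rule that[of "\<lambda>x. g (\<pi> x)"])
      (unfold_locales, simp_all add: g.add \<pi>.add g.scale \<pi>.scale \<pi> g g.zero)
qed

end

text \<open>Newton iteration for a root of \<open>t\<^sup>2 - l t + m\<close> starting at \<open>t\<close>; in characteristic 2 the step is
  \<open>f \<mapsto> f + r(f) / l\<close>, which squares \<open>r(f)\<close> up to a scalar.\<close>
lemma char2_approximate_root:
  fixes l m :: "'a::field"
  assumes "l \<noteq> 0" "(1::'a) + 1 = 0"
  defines "r \<equiv> [:m, - l, 1:]"
  shows "\<exists>f. r dvd f - [:0, 1:] \<and> r ^ n dvd f * f - Polynomial.smult l f + [:m:]"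
proof (cases n)
  case 0
  then have "r ^ n dvd g" for g by simp
  then show ?thesis by (intro exI[of _ "[:0, 1:]"]) simp
next
  case (Suc k)
  have c2: "p + p = 0" for p :: "'a poly"
  proof -
    have "p + p = Polynomial.smult (1 + 1) p" by (simp only: smult_add_left smult_1_left)
    then show ?thesis using assms(2) by simp
  qed
  \<comment> \<open>The induction starts at exponent 1: the correction \<open>h\<close> must be
    divisible by \<open>r\<close>, so that \<open>f\<close> stays congruent to \<open>t\<close>
    modulo \<open>r\<close>.\<close>
  have "\<exists>f. r dvd f - [:0, 1:] \<and> r ^ Suc k dvd f * f - Polynomial.smult l f + [:m:]" for k
  proof (induction k)
    case 0
    show ?case by (intro exI[of _ "[:0, 1:]"]) (simp add: r_def)
  next
    case (Suc k)
    then obtain f where f: "r dvd f - [:0, 1:]" "r ^ Suc k dvd f * f - Polynomial.smult l f + [:m:]" by blast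
    define g where "g = f * f - Polynomial.smult l f + [:m:]"
    define h where "h = Polynomial.smult (inverse l) g"
    have lh: "Polynomial.smult l h = g" using assms(1) by (simp add: h_def)
    have "(f + h) * (f + h) - Polynomial.smult l (f + h) + [:m:] = g - Polynomial.smult l h + h * h + (f * h + f * h)"
      by (simp add: g_def algebra_simps smult_add_right)
    also have "\<dots> = h * h" by (simp add: c2 lh)
    finally have eq: "(f + h) * (f + h) - Polynomial.smult l (f + h) + [:m:] = h * h" .
    have "r ^ Suc k dvd h" using f(2) by (simp add: h_def g_def dvd_smult)
    moreover from this have "r dvd h" by (metis dvd_mult_left power_Suc)
    ultimately have "r * r ^ Suc k dvd h * h" and "r dvd (f - [:0,1:]) + h"
      using f(1) by (auto intro: mult_dvd_mono dvd_add)
    then have "r dvd (f + h) - [:0, 1:]"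
      "r ^ Suc (Suc k) dvd (f + h) * (f + h) - Polynomial.smult l (f + h) + [:m:]"
      unfolding eq by (simp_all add: algebra_simps)
    then show ?case by blast
  qed
  then show ?thesis using Suc by blast
qed

section \<open>Differences of quadratic endomorphisms\<close>

context finite_dimensional_vector_space
begin

text \<open>After translation by \<open>y1\<close>, \<open>w1\<close> is to be annihilated by
  \<open>t * t - l * t + m\<close> and \<open>w2\<close> by \<open>t * t - d * t\<close>; the
  alternative for \<open>d\<close> is what the equality of the two translates of \<open>p\<close>
  amounts to.\<close>

lemma quadratic_difference:
  assumes v: "Vector_Spaces.linear scale scale v"
    and irr: "\<And>e. e * e - l * e + m \<noteq> 0"
    and nil: "\<And>x. (poly_endo scale [:m, - l, 1:] v ^^ n) x = 0"
    and d: "d = 0 \<or> d = l \<and> (1::'a) + 1 = 0"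
  shows "\<exists>w1 w2. Vector_Spaces.linear scale scale w1 \<and> Vector_Spaces.linear scale scale w2 \<and>
    (\<forall>x. v x = w1 x - w2 x) \<and>
    (\<forall>x. w1 (w1 x) = scale l (w1 x) - scale m x) \<and> (\<forall>x. w2 (w2 x) = scale d (w2 x))"
proof (cases "d = 0")
  case True
  interpret v: Vector_Spaces.linear scale scale v by fact
  define z where "z = poly_endo scale [:m, - l, 1:] v"
  have z: "z x = scale m x - scale l (v x) + v (v x)" for x
    by (simp add: z_def poly_endo_pCons[OF v] v.zero v.add v.diff v.scale v.neg)
  have lz: "Vector_Spaces.linear scale scale z" unfolding z_def by (rule linear_poly_endo[OF v])
  interpret z: Vector_Spaces.linear scale scale z by (rule lz)
  have comm: "v (z x) = z (v x)" for x unfolding z_def by (rule poly_endo_commute[OF v, symmetric])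
  obtain W where W: "subspace W" "z ` W \<subseteq> W" "\<And>w. w \<in> W \<Longrightarrow> v w \<in> W \<Longrightarrow> w = 0"
    "\<And>x. \<exists>w\<in>W. \<exists>w'\<in>W. x = w + v w'"
  proof -
    have "v (v x) = scale l (v x) - scale m x" if "z x = 0" for x
      using that by (simp add: z algebra_simps eq_neg_iff_add_eq_0)
    then show ?thesis
      using nilpotent_split[OF v lz comm irr subspace_UNIV, of n] nil that by (auto simp: z_def)
  qed
  obtain Q where Q: "Vector_Spaces.linear scale scale Q" "\<And>w. w \<in> W \<Longrightarrow> Q w = 0" "\<And>w. w \<in> W \<Longrightarrow> Q (v w) = w"
    using split_coordinate[OF v W(1,3)] by metis
  interpret Q: Vector_Spaces.linear scale scale Q by fact
  define w2 where "w2 x = - z (Q x)" for x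
  define w1 where "w1 x = v x + w2 x" for x
  have lw2: "Vector_Spaces.linear scale scale w2"
    unfolding w2_def by unfold_locales (simp_all add: Q.add z.add Q.scale z.scale)
  interpret w2: Vector_Spaces.linear scale scale w2 by fact
  have lw1: "Vector_Spaces.linear scale scale w1"
    unfolding w1_def by unfold_locales (simp_all add: v.add w2.add v.scale w2.scale scale_right_distrib)
  interpret w1: Vector_Spaces.linear scale scale w1 by fact
  \<comment> \<open>Since \<open>z w = m w - l (v w) + v (v w)\<close>, subtracting
    \<open>z w\<close> from \<open>v (v w)\<close> restores the quadratic relation.\<close>
  have w1W: "w1 w = v w" "w1 (v w) = scale l (v w) - scale m w" if "w \<in> W" for w
    using that by (simp_all add: w1_def w2_def Q z.zero z)
  have "w1 (w1 x) = scale l (w1 x) - scale m x" for x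
  proof -
    obtain w w' where "w \<in> W" "w' \<in> W" "x = w + v w'" using W(4) by blast
    then show ?thesis
      by (simp add: w1.add w1W w1.diff w1.scale scale_right_diff_distrib scale_right_distrib)
  qed
  \<comment> \<open>\<open>w2\<close> takes its values in the \<open>z\<close>-stable subspace
    \<open>W\<close>, and \<open>Q\<close> kills \<open>W\<close>.\<close>
  moreover have "w2 (w2 x) = 0" for x
  proof -
    obtain w w' where w: "w \<in> W" "w' \<in> W" "x = w + v w'" using W(4) by blast
    then have "w2 x = - z w'" by (simp add: w2.add) (simp add: w2_def Q z.zero)
    moreover have "z w' \<in> W" using w W(2) by auto
    ultimately show ?thesis by (simp add: w2.neg) (simp add: w2_def Q z.zero)
  qed
  moreover have "v x = w1 x - w2 x" for x by (simp add: w1_def)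
  ultimately show ?thesis using lw1 lw2 True by (intro exI[of _ w1] exI[of _ w2]) simp
next
  case False
  then have dl: "d = l" and "l \<noteq> 0" and two: "(1::'a) + 1 = 0" using d by auto
  interpret v: Vector_Spaces.linear scale scale v by fact
  define r where "r = [:m, - l, 1:]"
  obtain f where f: "r dvd f - [:0, 1:]" "r ^ n dvd f * f - Polynomial.smult l f + [:m:]"
    using char2_approximate_root[OF \<open>l \<noteq> 0\<close> two] unfolding r_def by blast
  \<comment> \<open>As \<open>r ^ n\<close> annihilates \<open>v\<close>, \<open>a\<close> satisfies
    the quadratic relation; \<open>b\<close> is nilpotent because \<open>r\<close> divides
    \<open>t - f\<close>.\<close>
  define a where "a = poly_endo scale f v"
  define b where "b = poly_endo scale ([:0, 1:] - f) v"
  have X: "poly_endo scale [:0, 1:] v x = v x" for x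
    by (simp add: poly_endo_pCons[OF v] v.zero)
  have la: "Vector_Spaces.linear scale scale a" and lb: "Vector_Spaces.linear scale scale b"
    unfolding a_def b_def by (rule linear_poly_endo[OF v])+
  interpret a: Vector_Spaces.linear scale scale a by (rule la)
  interpret b: Vector_Spaces.linear scale scale b by (rule lb)
  have vab: "v x = a x + b x" for x by (simp add: b_def a_def poly_endo_diff X)
  have comm: "a (b x) = b (a x)" for x
    unfolding a_def b_def poly_endo_mult[OF v, symmetric] by (simp add: mult.commute)
  have kill: "poly_endo scale g v x = 0" if "r ^ n dvd g" for g x
  proof -
    obtain h where "g = r ^ n * h" using \<open>r ^ n dvd g\<close> by (rule dvdE)
    then have "g = h * r ^ n" by (simp only: mult.commute)
    interpret h: Vector_Spaces.linear scale scale "poly_endo scale h v" by (rule linear_poly_endo[OF v])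
    show ?thesis using nil by (simp add: \<open>g = h * r ^ n\<close> poly_endo_mult[OF v] poly_endo_power[OF v] h.zero r_def)
  qed
  have quad: "a (a x) = scale l (a x) - scale m x" for x
  proof -
    have "poly_endo scale (f * f - Polynomial.smult l f + [:m:]) v x = 0" by (rule kill[OF f(2)])
    then show ?thesis
      by (simp add: poly_endo_add poly_endo_diff poly_endo_mult[OF v] poly_endo_smult poly_endo_pCons[OF v] v.zero
          a_def algebra_simps eq_neg_iff_add_eq_0)
  qed
  have nilb: "(b ^^ n) x = 0" for x
    unfolding b_def poly_endo_power[OF v, symmetric]
    using f(1) by (intro kill dvd_power_same) (subst dvd_diff_commute)
  obtain W where W: "subspace W" "b ` W \<subseteq> W" "\<And>w. w \<in> W \<Longrightarrow> a w \<in> W \<Longrightarrow> w = 0"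
    "\<And>x. \<exists>w\<in>W. \<exists>w'\<in>W. x = w + a w'"
    using nilpotent_split[OF la lb comm irr subspace_UNIV _ _ nilb quad] by auto
  obtain A B where AB: "subspace A" "subspace B" "A \<inter> B = {0}" "b ` A \<subseteq> B" "b ` B \<subseteq> A"
    "A \<subseteq> W" "B \<subseteq> W" "\<And>x. x \<in> W \<Longrightarrow> \<exists>y\<in>A. \<exists>z\<in>B. x = y + z"
    using nilpotent_grading[OF lb W(1,2) nilb] by metis
  obtain Q where Q: "Vector_Spaces.linear scale scale Q" "\<And>w. w \<in> W \<Longrightarrow> Q w = 0" "\<And>w. w \<in> W \<Longrightarrow> Q (a w) = w"
    using split_coordinate[OF la W(1,3)] by metis
  obtain \<pi> where \<pi>: "Vector_Spaces.linear scale scale \<pi>" "\<And>x. x \<in> A \<Longrightarrow> \<pi> x = x" "\<And>x. x \<in> B \<Longrightarrow> \<pi> x = 0"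
    using projection_exists[OF AB(1-3)] by metis
  interpret Q: Vector_Spaces.linear scale scale Q by fact
  interpret \<pi>: Vector_Spaces.linear scale scale \<pi> by fact
  \<comment> \<open>On \<open>w + a w'\<close> this is \<open>\<pi> w + a (\<pi> w')\<close>, so
    \<open>P\<close> is the projection onto \<open>A + a A\<close> along
    \<open>B + a B\<close>.\<close>
  define P where "P x = \<pi> (x - a (Q x)) + a (\<pi> (Q x))" for x
  have lP: "Vector_Spaces.linear scale scale P"
    unfolding P_def by unfold_locales
      (simp_all add: \<pi>.add \<pi>.diff Q.add a.add \<pi>.scale Q.scale a.scale scale_right_distrib scale_right_diff_distrib)
  interpret P: Vector_Spaces.linear scale scale P by fact
  have PW: "P w = \<pi> w" "P (a w) = a (\<pi> w)" if "w \<in> W" for w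
    using that by (simp_all add: P_def Q a.zero \<pi>.zero)
  have PA: "P x = x" "P (a x) = a x" if "x \<in> A" for x using that PW[of x] AB \<pi> by auto
  have PB: "P x = 0" "P (a x) = 0" if "x \<in> B" for x using that PW[of x] AB \<pi> a.zero by auto
  \<comment> \<open>Every vector has four components on which \<open>P\<close>, \<open>a\<close> and
    \<open>b\<close> are understood; the identities below are checked on their sum.\<close>
  have dec: thesis
    if "\<And>x1 x2 x3 x4. x1 \<in> A \<Longrightarrow> x2 \<in> B \<Longrightarrow> x3 \<in> A \<Longrightarrow> x4 \<in> B \<Longrightarrow> x = x1 + x2 + (a x3 + a x4) \<Longrightarrow> thesis" for x thesis
  proof -
    obtain w w' where "w \<in> W" "w' \<in> W" "x = w + a w'" using W(4) by blast
    moreover obtain x1 x2 where "x1 \<in> A" "x2 \<in> B" "w = x1 + x2" using AB(8) \<open>w \<in> W\<close> by blast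
    moreover obtain x3 x4 where "x3 \<in> A" "x4 \<in> B" "w' = x3 + x4" using AB(8) \<open>w' \<in> W\<close> by blast
    ultimately show thesis using that[of x1 x2 x3 x4] by (simp add: a.add)
  qed
  have PP: "P (P x) = P x" for x
    by (rule dec[of x]) (simp add: P.add P.zero PA PB)
  have Pa: "P (a x) = a (P x)" for x
    by (rule dec[of x]) (simp add: P.add a.add P.zero a.zero PA PB quad P.diff P.scale)
  \<comment> \<open>\<open>b\<close> commutes with \<open>a\<close> and exchanges \<open>A\<close>
    and \<open>B\<close>, so \<open>P\<close> kills \<open>b (P x)\<close> and fixes
    \<open>b (x - P x)\<close>.\<close>
  have bP: "P (b x) = b x - b (P x)" for x
  proof (rule dec[of x])
    fix x1 x2 x3 x4 assume *: "x1 \<in> A" "x2 \<in> B" "x3 \<in> A" "x4 \<in> B" "x = x1 + x2 + (a x3 + a x4)"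
    then have "b x1 \<in> B" "b x2 \<in> A" "b x3 \<in> B" "b x4 \<in> A" using AB by auto
    then show ?thesis using *
      by (simp add: P.add b.add P.zero b.zero PA PB comm[symmetric])
  qed
  define w2 where "w2 x = scale l (P x) + (b x - b (P x))" for x
  define w1 where "w1 x = a x + scale l (P x) + b (P x)" for x
  have c2: "x + x = 0" for x :: 'b
    using two scale_left_distrib[of 1 1 x] by simp
  then have neg: "- x = x" for x :: 'b
    by (metis add_eq_0_iff)
  have lw1: "Vector_Spaces.linear scale scale w1" and lw2: "Vector_Spaces.linear scale scale w2"
    unfolding w1_def w2_def by (unfold_locales;
      simp add: P.add b.add P.scale b.scale a.add a.scale scale_right_distrib scale_right_diff_distrib mult.commute)+
  \<comment> \<open>The difference is \<open>a + 2 b P - b\<close>, which in characteristic 2 equals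
    \<open>a + b\<close>.\<close>
  have "w1 x - w2 x = a x + (b (P x) + b (P x)) - b x" for x by (simp add: w1_def w2_def algebra_simps)
  then have "v x = w1 x - w2 x" for x using neg[of "b x"] by (simp add: c2 vab diff_conv_add_uminus del: add_uminus_conv_diff)
  moreover have "w1 (w1 x) = scale l (w1 x) - scale m x" for x
  proof -
    \<comment> \<open>Products containing \<open>P b P\<close> vanish by \<open>bP\<close>; the
      terms in \<open>a P\<close> and \<open>b a P\<close> occur twice and cancel in characteristic
      2.\<close>
    have "w1 (w1 x) = scale l (a x) - scale m x + (scale l (scale l (P x)) + scale l (b (P x)))
        + (scale l (a (P x)) + scale l (a (P x))) + (b (a (P x)) + b (a (P x)))"
      by (simp add: w1_def quad PP bP Pa comm a.add b.add P.add a.scale b.scale P.scale scale_right_distrib algebra_simps b.zero)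
    then show ?thesis by (simp add: c2 w1_def scale_right_distrib algebra_simps)
  qed
  \<comment> \<open>By \<open>bP\<close>, \<open>P b (1 - P) = b (1 - P)\<close> and
    \<open>(1 - P) b (1 - P) = 0\<close>.\<close>
  moreover have "w2 (w2 x) = scale l (w2 x)" for x
    by (simp add: w2_def PP bP P.add P.diff b.add b.diff P.scale b.scale scale_right_distrib scale_right_diff_distrib)
  ultimately show ?thesis using lw1 lw2 dl by blast
qed

end

section \<open>Eigenvalues in the algebraic closure\<close>

text \<open>Split off a linear factor, \<open>g = (t - l) * h\<close>: either \<open>h(T) c\<close>
  is an eigenvector for \<open>l\<close>, or \<open>h\<close> already annihilates \<open>c\<close>
  and has smaller degree. \<open>S\<close> is carried along because the scalar extension will be a
  subspace of a function type.\<close>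

lemma eigenvector_of_annihilating_poly:
  fixes scale :: "'k::alg_closed_field \<Rightarrow> 'w::ab_group_add \<Rightarrow> 'w"
  assumes "vector_space scale" "Vector_Spaces.linear scale scale T"
    and S: "module.subspace scale S" "T ` S \<subseteq> S"
    and "c \<in> S" "c \<noteq> 0" "g \<noteq> 0" "poly_endo scale g T c = 0"
  shows "\<exists>l w. poly g l = 0 \<and> w \<in> S \<and> w \<noteq> 0 \<and> T w = scale l w"
  using assms(7,8)
proof (induction "Polynomial.degree g" arbitrary: g rule: less_induct)
  case less
  interpret vector_space scale by fact
  interpret T: Vector_Spaces.linear scale scale T by fact
  note pC = poly_endo_pCons[OF assms(2)]
  have mem: "poly_endo scale h T c \<in> S" for h
    using S assms(5) by (induction h) (auto simp: pC intro!: subspace_add subspace_scale subspace_0)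
  show ?case
  proof (cases "Polynomial.degree g = 0")
    case True
    then obtain a where "g = [:a:]" by (metis degree_eq_zeroE)
    then have "scale a c = 0" "a \<noteq> 0" using less.prems by (auto simp: pC T.zero)
    then show ?thesis using assms(6) by simp
  next
    case False
    then obtain l where l: "poly g l = 0" using alg_closed_imp_poly_has_root by blast
    then obtain h where h: "g = [:- l, 1:] * h" by (auto simp: poly_eq_0_iff_dvd elim: dvdE)
    have "h \<noteq> 0" using h less.prems by auto
    show ?thesis
    proof (cases "poly_endo scale h T c = 0")
      case True
      have "Polynomial.degree h < Polynomial.degree g"
        using \<open>h \<noteq> 0\<close> by (simp add: h degree_mult_eq del: mult_pCons_left)
      from less.hyps[OF this \<open>h \<noteq> 0\<close> True] show ?thesis by (auto simp: h)
    next
      case False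
      have "T (poly_endo scale h T c) = scale l (poly_endo scale h T c)"
        using less.prems(2) unfolding h poly_endo_mult[OF assms(2)] by (simp add: pC T.zero)
      then show ?thesis using False l mem by blast
    qed
  qed
qed

interpretation to_ac_poly: map_poly_comm_ring_hom to_ac
  by unfold_locales auto

context finite_dimensional_vector_space
begin

text \<open>The iterates of \<open>x\<close> up to exponent \<open>dimension\<close> are too many to
  be independent. Dependence is stated for sets, so a repeated iterate is treated apart, by the
  difference of two monomials.\<close>

lemma annihilating_poly_exists: "\<exists>f. f \<noteq> 0 \<and> poly_endo scale f v x = 0"
proof (cases "inj_on (\<lambda>i. (v ^^ i) x) {..dimension}")
  case False
  then obtain i j where ij: "i \<noteq> j" "(v ^^ i) x = (v ^^ j) x" by (auto simp: inj_on_def)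
  define f :: "'a poly" where "f = Polynomial.monom 1 i - Polynomial.monom 1 j"
  have mon: "poly_endo scale (Polynomial.monom 1 k) v x = (v ^^ k) x" for k
    by (simp add: poly_endo_def Polynomial.degree_monom_eq if_distrib[of "\<lambda>c. scale c _"] cong: if_cong)
  have "f \<noteq> 0" using ij by (simp add: f_def monom_eq_iff')
  moreover have "poly_endo scale f v x = 0"
    using ij by (simp add: f_def poly_endo_diff mon)
  ultimately show ?thesis by blast
next
  case True
  let ?w = "\<lambda>i. (v ^^ i) x"
  have "card (?w ` {..dimension}) = Suc dimension" using card_image[OF True] by simp
  then have "dependent (?w ` {..dimension})"
    using dim_subset_UNIV[of "?w ` {..dimension}"] by (intro dependent_biggerset_general) simp
  then obtain u k where u: "k \<le> dimension" "u (?w k) \<noteq> 0" "(\<Sum>y\<in>?w ` {..dimension}. scale (u y) y) = 0"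
    by (subst (asm) dependent_finite) auto
  define f where "f = (\<Sum>i\<le>dimension. Polynomial.monom (u (?w i)) i)"
  have cf: "Polynomial.coeff f i = (if i \<le> dimension then u (?w i) else 0)" for i
    by (simp add: f_def Polynomial.coeff_sum)
  then have "Polynomial.coeff f k \<noteq> 0" "Polynomial.degree f \<le> dimension"
    using u by (auto intro: degree_le)
  moreover from this(2) have "poly_endo scale f v x = 0"
    using u(3) by (simp add: poly_endo_sum cf sum.reindex[OF True])
  ultimately show ?thesis by (intro exI[of _ f]) auto
qed

lemma representation_linear:
  assumes "Vector_Spaces.linear scale scale v"
  shows "representation Basis (v x) b
    = (\<Sum>b'\<in>Basis. representation Basis (v b') b * representation Basis x b')"
proof -
  interpret v: Vector_Spaces.linear scale scale v by fact
  have sp: "y \<in> span Basis" for y using span_Basis by auto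
  have "v x = v (\<Sum>b'\<in>Basis. scale (representation Basis x b') b')"
    using sum_representation_eq[OF independent_Basis sp finite_Basis subset_refl] by simp
  also have "\<dots> = (\<Sum>b'\<in>Basis. scale (representation Basis x b') (v b'))"
    by (simp add: v.sum v.scale)
  finally show ?thesis
    by (simp add: representation_sum representation_scale independent_Basis sp mult.commute)
qed

text \<open>Coordinates carry \<open>x\<close> into the scalar extension, where \<open>f\<close>
  still annihilates it; over the closure some root of \<open>f\<close> is then an eigenvalue, and
  its eigenvector, listed along a basis, is one of the matrix.\<close>

lemma eigenvalue_ac_of_annihilating_poly:
  assumes v: "Vector_Spaces.linear scale scale v"
    and f: "f \<noteq> 0" "poly_endo scale f v x = 0" and "x \<noteq> 0"
  shows "\<exists>l. eigenvalue_ac scale v l \<and> poly (map_poly to_ac f) l = 0"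
proof -
  \<comment> \<open>Functions \<open>Basis \<rightarrow> closure\<close>, extended by 0, model the scalar extension of the space.\<close>
  define fs :: "'a alg_closure \<Rightarrow> ('b \<Rightarrow> 'a alg_closure) \<Rightarrow> 'b \<Rightarrow> 'a alg_closure"
    where "fs k c b = k * c b" for k c b
  define T :: "('b \<Rightarrow> 'a alg_closure) \<Rightarrow> 'b \<Rightarrow> 'a alg_closure"
    where "T c b = (\<Sum>b'\<in>Basis. to_ac (representation Basis (v b') b) * c b')" for c b
  \<comment> \<open>The coordinate embedding of the original space into its scalar extension; it
    intertwines \<open>v\<close> with \<open>T\<close>.\<close>
  define \<kappa> where "\<kappa> y b = to_ac (representation Basis y b)" for y b
  define S :: "('b \<Rightarrow> 'a alg_closure) set" where "S = {c. \<forall>b. b \<notin> Basis \<longrightarrow> c b = 0}"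
  have sp: "y \<in> span Basis" for y using span_Basis by auto
  have rep0: "representation Basis y b = 0" if "b \<notin> Basis" for y b
    using that representation_ne_zero by blast
  interpret v: Vector_Spaces.linear scale scale v by fact
  have vs: "vector_space fs"
    by unfold_locales (auto simp: fs_def fun_eq_iff algebra_simps)
  interpret F: vector_space fs by (rule vs)
  have lT: "Vector_Spaces.linear fs fs T"
    by unfold_locales
      (auto simp: fs_def T_def fun_eq_iff algebra_simps sum.distrib sum_distrib_left intro!: sum.cong)
  have S: "F.subspace S" "T ` S \<subseteq> S"
    by (auto simp: F.subspace_def S_def fs_def T_def rep0)
  have \<kappa>S: "\<kappa> y \<in> S" for y by (simp add: S_def \<kappa>_def rep0)
  have \<kappa>_add: "\<kappa> (y + z) = \<kappa> y + \<kappa> z" for y z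
    by (rule ext) (simp add: \<kappa>_def representation_add[OF independent_Basis sp sp])
  have \<kappa>_scale: "\<kappa> (scale k y) = fs (to_ac k) (\<kappa> y)" for k y
    by (rule ext) (simp add: \<kappa>_def fs_def representation_scale[OF independent_Basis sp])
  have \<kappa>_0: "\<kappa> 0 = 0"
    by (rule ext) (simp add: \<kappa>_def representation_zero)
  note \<kappa>_lin = \<kappa>_add \<kappa>_scale \<kappa>_0
  have \<kappa>_v: "\<kappa> (v y) = T (\<kappa> y)" for y
    by (rule ext) (simp add: \<kappa>_def T_def representation_linear[OF v, of y] to_ac_sum)
  have \<kappa>_poly: "poly_endo fs (map_poly to_ac h) T (\<kappa> y) = \<kappa> (poly_endo scale h v y)" for h y
  proof (induction h)
    case 0
    then show ?case by (simp add: \<kappa>_lin)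
  next
    case (pCons a h)
    show ?case by (simp add: to_ac_poly.base.map_poly_pCons_hom F.poly_endo_pCons[OF lT] poly_endo_pCons[OF v] pCons.IH \<kappa>_lin \<kappa>_v)
  qed
  have "\<kappa> x \<noteq> 0"
  proof
    assume "\<kappa> x = 0"
    then have "representation Basis x b = 0" for b by (auto simp: \<kappa>_def fun_eq_iff)
    then have "x = 0"
      using sum_representation_eq[OF independent_Basis sp[of x] finite_Basis subset_refl] by simp
    with \<open>x \<noteq> 0\<close> show False by simp
  qed
  moreover have "poly_endo fs (map_poly to_ac f) T (\<kappa> x) = 0" by (simp add: \<kappa>_poly f \<kappa>_lin)
  moreover have "map_poly to_ac f \<noteq> 0" using f by (simp add: map_poly_eq_0_iff)
  ultimately obtain l w where lw: "poly (map_poly to_ac f) l = 0" "w \<in> S" "w \<noteq> 0" "T w = fs l w"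
    using eigenvector_of_annihilating_poly[OF vs lT S \<kappa>S] by blast
  \<comment> \<open>\<open>eigenvalue_ac\<close> asks for some ordered basis, so any enumeration of
    \<open>Basis\<close> serves.\<close>
  obtain bs where bs: "set bs = Basis" "distinct bs" using finite_distinct_list[OF finite_Basis] by blast
  have ob: "ordered_basis scale bs"
    using bs independent_Basis span_Basis by (simp add: ordered_basis_def)
  let ?n = "length bs"
  let ?M = "map_mat to_ac (matrix_of_endo scale bs v)"
  let ?u = "vec ?n (\<lambda>j. w (bs ! j))"
  have dim: "dim_row ?M = ?n" "dim_col ?M = ?n" by (simp_all add: matrix_of_endo_def)
  have bij: "bij_betw ((!) bs) {0..<?n} Basis"
    using bij_betw_nth[OF bs(2), of "{0..<?n}" Basis] bs(1) by (simp add: lessThan_atLeast0)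
  have "eigenvector ?M ?u l"
    unfolding eigenvector_def dim
  proof (intro conjI)
    show "?u \<noteq> 0\<^sub>v ?n"
    proof
      assume 0: "?u = 0\<^sub>v ?n"
      have "w (bs ! j) = 0" if "j < ?n" for j
        using arg_cong[OF 0, of "\<lambda>u. vec_index u j"] that by simp
      then have "w b = 0" if "b \<in> Basis" for b using that bs(1) by (metis in_set_conv_nth)
      then have "w = 0" using lw(2) by (auto simp: S_def fun_eq_iff)
      then show False using lw(3) by simp
    qed
    show "?M *\<^sub>v ?u = l \<cdot>\<^sub>v ?u"
    proof (rule eq_vecI)
      fix i assume "i < dim_vec (l \<cdot>\<^sub>v ?u)"
      then have i: "i < ?n" by simp
      have "vec_index (?M *\<^sub>v ?u) i = (\<Sum>j = 0..<?n. to_ac (representation Basis (v (bs ! j)) (bs ! i)) * w (bs ! j))"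
        using i by (simp add: scalar_prod_def matrix_of_endo_def bs(1))
      also have "\<dots> = T w (bs ! i)"
        unfolding T_def by (rule sum.reindex_bij_betw[OF bij])
      also have "\<dots> = vec_index (l \<cdot>\<^sub>v ?u) i" using i by (simp add: lw(4) fs_def)
      finally show "vec_index (?M *\<^sub>v ?u) i = vec_index (l \<cdot>\<^sub>v ?u) i" .
    qed (simp add: matrix_of_endo_def)
  qed simp
  then show ?thesis using lw(1) ob unfolding eigenvalue_ac_def eigenvalue_def by blast
qed

text \<open>A quadratic \<open>r\<close> without roots is irreducible, so a polynomial that it does
  not divide shares no root with it and is injective at \<open>v\<close>. Removing factors
  \<open>r\<close> from an annihilating polynomial of a vector thus yields a power of
  \<open>r(v)\<close> that kills it; the finite basis gives a common exponent.\<close>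

lemma nilpotent_of_eigenvalues:
  assumes v: "Vector_Spaces.linear scale scale v"
    and ev: "\<And>e. eigenvalue_ac scale v e \<Longrightarrow> e * e - to_ac l * e + to_ac m = 0"
    and irr: "\<And>e. e * e - l * e + m \<noteq> 0"
  shows "\<exists>n. \<forall>x. (poly_endo scale [:m, - l, 1:] v ^^ n) x = 0"
proof -
  define r where "r = [:m, - l, 1:]"
  let ?R = "poly_endo scale r v"
  interpret R: Vector_Spaces.linear scale scale ?R by (rule linear_poly_endo[OF v])
  have inj: "x = 0" if f: "\<not> r dvd f" "poly_endo scale f v x = 0" for f x
  proof (rule ccontr)
    assume "x \<noteq> 0"
    moreover have "f \<noteq> 0" using f by auto
    ultimately obtain e where e: "eigenvalue_ac scale v e" "poly (map_poly to_ac f) e = 0"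
      using eigenvalue_ac_of_annihilating_poly[OF v _ f(2)] by blast
    have re: "poly (map_poly to_ac r) e = 0"
      using ev[OF e(1)] by (simp add: r_def to_ac_poly.base.map_poly_pCons_hom algebra_simps)
    \<comment> \<open>The remainder \<open>b + a t\<close> also vanishes at \<open>e\<close>; with
      \<open>a\<close> non-zero, \<open>e = - b / a\<close> would lie in the ground field and be a
      root of \<open>r\<close> there.\<close>
    have "Polynomial.degree (f mod r) < 2"
      using degree_mod_less[of r f] by (auto simp: r_def)
    then have "f mod r = [:Polynomial.coeff (f mod r) 0, Polynomial.coeff (f mod r) 1:]"
      by (intro poly_eqI) (auto simp: coeff_pCons coeff_eq_0 split: nat.split)
    then obtain b a where ba: "f mod r = [:b, a:]" by blast
    have "map_poly to_ac f = map_poly to_ac (r * (f div r) + [:b, a:])" using ba by (metis mult_div_mod_eq)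
    then have "poly (map_poly to_ac [:b, a:]) e = 0"
      using e(2) re by (simp only: to_ac_poly.hom_add to_ac_poly.hom_mult poly_add poly_mult) simp
    then have ab: "to_ac b + e * to_ac a = 0" by (simp add: to_ac_poly.base.map_poly_pCons_hom)
    have "a = 0"
    proof (rule ccontr)
      assume "a \<noteq> 0"
      define e' where "e' = - b / a"
      have "e = to_ac e'"
        using ab \<open>a \<noteq> 0\<close> by (simp add: e'_def field_simps eq_neg_iff_add_eq_0 add.commute)
      then have "to_ac (e' * e' - l * e' + m) = 0"
        using ev[OF e(1)] by simp
      then show False using irr[of e'] by (simp only: to_ac_eq_0_iff)
    qed
    then have "f mod r = 0" using ab ba by simp
    then show False using f(1) by (simp add: mod_eq_0_iff_dvd)
  qed
  have ex: "\<exists>k. (?R ^^ k) x = 0" if "f \<noteq> 0" "poly_endo scale f v x = 0" for f x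
    using that
  proof (induction "Polynomial.degree f" arbitrary: f x rule: less_induct)
    case less
    show ?case
    proof (cases "r dvd f")
      case False
      then have "x = 0" using inj less.prems by blast
      then show ?thesis by (intro exI[of _ 0]) simp
    next
      case True
      then obtain g where g: "f = r * g" by (rule dvdE)
      then have "g \<noteq> 0" using less.prems by auto
      have "Polynomial.degree f = Polynomial.degree r + Polynomial.degree g"
        using \<open>g \<noteq> 0\<close> unfolding g by (intro degree_mult_eq) (auto simp: r_def)
      then have deg: "Polynomial.degree g < Polynomial.degree f" by (simp add: r_def)
      have "poly_endo scale g v (?R x) = 0"
        using less.prems(2) by (simp add: g poly_endo_mult[OF v, symmetric] mult.commute)
      from less.hyps[OF deg \<open>g \<noteq> 0\<close> this] obtain k where "(?R ^^ k) (?R x) = 0" ..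
      then show ?thesis by (intro exI[of _ "Suc k"]) (simp add: funpow_swap1)
    qed
  qed
  have "\<exists>k. (?R ^^ k) x = 0" for x
    using annihilating_poly_exists[of v x] ex by blast
  then obtain k where k: "\<And>x. (?R ^^ k x) x = 0" by metis
  \<comment> \<open>For an empty \<open>Basis\<close> this value is unspecified, and the claim about
    basis vectors is vacuous.\<close>
  define n where "n = Max (k ` Basis)"
  have pow0: "(?R ^^ i) 0 = 0" for i by (induction i) (simp_all add: R.zero)
  have "(?R ^^ n) b = 0" if "b \<in> Basis" for b
  proof -
    have "k b \<le> n" unfolding n_def using that finite_Basis by simp
    then have "(?R ^^ n) b = (?R ^^ (n - k b)) ((?R ^^ k b) b)"
      by (metis comp_apply funpow_add le_add_diff_inverse2)
    then show ?thesis by (simp add: k pow0)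
  qed
  moreover have "subspace {x. (?R ^^ n) x = 0}"
  proof -
    have "poly_endo scale (r ^ n) v = ?R ^^ n" by (rule ext) (rule poly_endo_power[OF v])
    then interpret Rn: Vector_Spaces.linear scale scale "?R ^^ n"
      using linear_poly_endo[OF v, of "r ^ n"] by simp
    show ?thesis by (auto simp: subspace_def Rn.zero Rn.add Rn.scale)
  qed
  ultimately have "span Basis \<subseteq> {x. (?R ^^ n) x = 0}" by (intro span_minimal) auto
  then show ?thesis using span_Basis by (auto simp: r_def)
qed

end

section \<open>The symplectic extension\<close>

lemma sum_fun_apply: "(\<Sum>i\<in>I. f i) y = (\<Sum>i\<in>I. f i y)"
  by (induction I rule: infinite_finite_induct) auto

context vector_space
begin

lemma dual_space_iff:
  "\<phi> \<in> dual_space scale \<longleftrightarrow>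
    (\<forall>x y. \<phi> (x + y) = \<phi> x + \<phi> y) \<and> (\<forall>c x. \<phi> (scale c x) = c * \<phi> x)"
proof
  assume "\<phi> \<in> dual_space scale"
  then interpret \<phi>: Vector_Spaces.linear scale "(*)" \<phi> by (simp add: dual_space_def)
  show "(\<forall>x y. \<phi> (x + y) = \<phi> x + \<phi> y) \<and> (\<forall>c x. \<phi> (scale c x) = c * \<phi> x)"
    by (simp add: \<phi>.add \<phi>.scale)
next
  assume "(\<forall>x y. \<phi> (x + y) = \<phi> x + \<phi> y) \<and> (\<forall>c x. \<phi> (scale c x) = c * \<phi> x)"
  then have "Vector_Spaces.linear scale (*) \<phi>"
    by unfold_locales (simp_all add: algebra_simps)
  then show "\<phi> \<in> dual_space scale" by (simp add: dual_space_def)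
qed

lemma vector_space_ext_scale: "vector_space (ext_scale scale)"
  by unfold_locales
    (auto simp: ext_scale_def fun_eq_iff algebra_simps scale_right_distrib scale_left_distrib)

lemma subspace_ext_space: "module.subspace (ext_scale scale) (ext_space scale)"
proof -
  interpret E: vector_space "ext_scale scale" by (rule vector_space_ext_scale)
  show ?thesis
    by (auto simp: E.subspace_def ext_space_def ext_scale_def dual_space_iff zero_prod_def algebra_simps)
qed

text \<open>The form at \<open>(x, \<phi>)\<close> and its image is
  \<open>\<phi> (u x) - \<phi> (u x)\<close>.\<close>

lemma ext_endo_alternating:
  assumes "Vector_Spaces.linear scale scale u"
  shows "alternating_endo (ext_scale scale) (ext_space scale) ext_form (ext_endo u)"
proof -
  interpret u: Vector_Spaces.linear scale scale u by fact
  show ?thesis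
    by (auto simp: alternating_endo_def endo_on_def ext_space_def ext_scale_def ext_endo_def ext_form_def
        dual_space_iff fun_eq_iff u.add u.scale)
qed

text \<open>Transposition reverses products, which does not affect powers of a single
  \<open>u\<close>; hence a polynomial that annihilates \<open>u\<close> also annihilates its
  extension.\<close>

lemma poly_endo_ext_endo:
  assumes "\<phi> \<in> dual_space scale"
  shows "poly_endo (ext_scale scale) p (ext_endo u) (x, \<phi>)
    = (poly_endo scale p u x, \<phi> \<circ> poly_endo scale p u)"
proof -
  interpret \<phi>: Vector_Spaces.linear scale "(*)" \<phi> using assms by (simp add: dual_space_def)
  have pow: "(ext_endo u ^^ i) (x, \<phi>) = ((u ^^ i) x, \<phi> \<circ> (u ^^ i))" for i
    by (induction i) (auto simp: ext_endo_def fun_eq_iff funpow_swap1)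
  show ?thesis
    by (auto simp: poly_endo_def prod_eq_iff fst_sum snd_sum pow ext_scale_def fun_eq_iff sum_fun_apply
        \<phi>.sum \<phi>.scale)
qed

end

context finite_dimensional_vector_space
begin

lemma coordinate_in_dual_space: "(\<lambda>x. representation Basis x b) \<in> dual_space scale"
  using span_Basis
  by (simp add: dual_space_iff representation_add[OF independent_Basis] representation_scale[OF independent_Basis])

lemma functional_expand:
  assumes "\<phi> \<in> dual_space scale"
  shows "\<phi> x = (\<Sum>b\<in>Basis. \<phi> b * representation Basis x b)"
proof -
  interpret \<phi>: Vector_Spaces.linear scale "(*)" \<phi> using assms by (simp add: dual_space_def)
  have "x \<in> span Basis" using span_Basis by simp
  then have "\<phi> x = \<phi> (\<Sum>b\<in>Basis. scale (representation Basis x b) b)"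
    using sum_representation_eq[OF independent_Basis _ finite_Basis subset_refl, of x] by simp
  also have "\<dots> = (\<Sum>b\<in>Basis. \<phi> b * representation Basis x b)"
    by (simp add: \<phi>.sum \<phi>.scale mult.commute)
  finally show ?thesis .
qed

text \<open>A basis of the space together with its coordinate functionals spans.\<close>

lemma fin_dim_ext_space: "fin_dim_space (ext_scale scale) (ext_space scale)"
proof -
  interpret E: vector_space "ext_scale scale" by (rule vector_space_ext_scale)
  define e where "e b = (b, 0 :: 'b \<Rightarrow> 'a)" for b :: 'b
  define e' where "e' b = (0 :: 'b, \<lambda>x. representation Basis x b)" for b
  let ?C = "e ` Basis \<union> e' ` Basis"
  have "?C \<subseteq> ext_space scale"
    using coordinate_in_dual_space by (auto simp: e_def e'_def ext_space_def dual_space_iff)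
  then have "E.span ?C \<subseteq> ext_space scale" using subspace_ext_space by (rule E.span_minimal)
  moreover have "(x, \<phi>) \<in> E.span ?C" if \<phi>: "\<phi> \<in> dual_space scale" for x \<phi>
  proof -
    have "x \<in> span Basis" using span_Basis by simp
    then have "(\<Sum>b\<in>Basis. scale (representation Basis x b) b) = x"
      using sum_representation_eq[OF independent_Basis _ finite_Basis subset_refl, of x] by simp
    then have "(x, \<phi>) = (\<Sum>b\<in>Basis. ext_scale scale (representation Basis x b) (e b))
        + (\<Sum>b\<in>Basis. ext_scale scale (\<phi> b) (e' b))"
      by (simp add: prod_eq_iff fst_sum snd_sum ext_scale_def e_def e'_def fun_eq_iff sum_fun_apply
          functional_expand[OF \<phi>, symmetric])
    also have "\<dots> \<in> E.span ?C"
      by (intro E.span_add E.span_sum E.span_scale E.span_base) auto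
    finally show ?thesis .
  qed
  ultimately have "E.span ?C = ext_space scale" by (auto simp: ext_space_def)
  moreover have "finite ?C" using finite_Basis by simp
  ultimately show ?thesis
    unfolding fin_dim_space_def by (intro conjI exI[of _ ?C] vector_space_ext_scale)
qed

lemma symplectic_form_ext_form: "symplectic_form (ext_scale scale) (ext_space scale) ext_form"
proof -
  have "bilinear_on (ext_scale scale) (ext_space scale) ext_form"
    by (auto simp: bilinear_on_def ext_space_def ext_scale_def ext_form_def dual_space_iff algebra_simps)
  moreover have "z = 0"
    if z: "z \<in> ext_space scale" "\<forall>y\<in>ext_space scale. ext_form z y = 0" for z
  proof -
    obtain x \<phi> where [simp]: "z = (x, \<phi>)" by (cases z)
    have \<phi>: "\<phi> \<in> dual_space scale" using z(1) by (simp add: ext_space_def)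
    have form: "\<phi> y - \<psi> x = 0" if "\<psi> \<in> dual_space scale" for y \<psi>
      using z(2) that by (auto simp: ext_space_def ext_form_def)
    \<comment> \<open>Pairing with all \<open>(y, 0)\<close> shows that \<phi> vanishes; pairing
      with the coordinate functionals then shows that \<open>x\<close> does.\<close>
    have "(\<lambda>_. 0) \<in> dual_space scale" by (simp add: dual_space_iff)
    then have "\<phi> y = 0" for y using form by fastforce
    moreover from this have "representation Basis x b = 0" for b
      using form[OF coordinate_in_dual_space] by simp
    moreover have "x \<in> span Basis" using span_Basis by simp
    ultimately have "x = 0" "\<phi> = 0"
      using sum_representation_eq[OF independent_Basis _ finite_Basis subset_refl, of x] by auto
    then show ?thesis by (simp add: zero_prod_def)
  qed
  ultimately show ?thesis
    using fin_dim_ext_space by (auto simp: symplectic_form_def ext_form_def)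
qed

text \<open>Passing to \<open>ext_endo\<close> preserves differences and annihilating polynomials,
  and its values are always alternating.\<close>

lemma symplectic_difference_extension:
  assumes "Vector_Spaces.linear scale scale u1" "Vector_Spaces.linear scale scale u2"
    and "\<And>x. v x = u1 x - u2 x"
    and "\<And>x. poly_endo scale p u1 x = 0" "\<And>x. poly_endo scale q u2 x = 0"
  shows "symplectic_difference (ext_scale scale) (ext_space scale) p q (symplectic_extension v)"
proof -
  interpret u1: Vector_Spaces.linear scale scale u1 by fact
  interpret u2: Vector_Spaces.linear scale scale u2 by fact
  have "Vector_Spaces.linear scale scale v"
    by unfold_locales (simp_all add: assms(3) u1.add u2.add u1.scale u2.scale scale_right_diff_distrib)
  then have "symplectic_pair (ext_scale scale) (ext_space scale) (ext_form, ext_endo v)"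
    using symplectic_form_ext_form ext_endo_alternating by (simp add: symplectic_pair_def)
  \<comment> \<open>The second component uses the linearity of \<phi>, hence the restriction to
    \<open>ext_space\<close>.\<close>
  moreover have "ext_endo v z = ext_endo u1 z - ext_endo u2 z" if z: "z \<in> ext_space scale" for z
  proof -
    obtain x \<phi> where [simp]: "z = (x, \<phi>)" and "\<phi> \<in> dual_space scale"
      using z by (auto simp: ext_space_def)
    then interpret \<phi>: Vector_Spaces.linear scale "(*)" \<phi> by (simp add: dual_space_def)
    show ?thesis by (auto simp: ext_endo_def fun_eq_iff assms(3) \<phi>.diff)
  qed
  moreover have "poly_endo (ext_scale scale) h (ext_endo u) z = 0"
    if h: "\<And>x. poly_endo scale h u x = 0" and z: "z \<in> ext_space scale" for h u z
  proof -
    obtain x \<phi> where zeq: "z = (x, \<phi>)" and \<phi>: "\<phi> \<in> dual_space scale"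
      using z by (auto simp: ext_space_def)
    then interpret \<phi>: Vector_Spaces.linear scale "(*)" \<phi> by (simp add: dual_space_def)
    show ?thesis
      using poly_endo_ext_endo[OF \<phi>, of h u x] h by (simp add: zeq zero_prod_def fun_eq_iff \<phi>.zero)
  qed
  ultimately show ?thesis
    using ext_endo_alternating assms unfolding symplectic_difference_def symplectic_extension_def by blast
qed

end

section \<open>Translating \<open>p\<close> and \<open>q\<close> by \<open>y1\<close>\<close>

theorem theorem4p7:
  fixes scale :: "'a::field \<Rightarrow> 'v::ab_group_add \<Rightarrow> 'v"
    and Basis :: "'v set"
    and p q :: "'a poly"
    and y1 y2 :: 'a
    and v :: "'v \<Rightarrow> 'v"
  assumes "monic p" and "Polynomial.degree p = 2"
    and "monic q" and "Polynomial.degree q = 2"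
    and "Factorial_Ring.irreducible p"
    and "q = [:- y1, 1:] * [:- y2, 1:]"
    and "pcompose p [:y1, 1:] = pcompose p [:y2, 1:]"
    and "finite_dimensional_vector_space scale Basis"
    and "Vector_Spaces.linear scale scale v"
    and "exceptional scale p q v"
  shows "symplectic_difference (ext_scale scale) (ext_space scale) p q (symplectic_extension v)"
proof -
  interpret finite_dimensional_vector_space scale Basis by fact
  define p0 p1 where "p0 = Polynomial.coeff p 0" and "p1 = Polynomial.coeff p 1"
  have p: "p = [:p0, p1, 1:]"
  proof (rule poly_eqI)
    fix n :: nat
    consider "n = 0" | "n = 1" | "n = 2" | "n > 2" by linarith
    then show "Polynomial.coeff p n = Polynomial.coeff [:p0, p1, 1:] n"
      using assms(1,2) by cases (auto simp: p0_def p1_def coeff_eq_0 coeff_pCons numeral_2_eq_2 split: nat.split)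
  qed
  \<comment> \<open>These compare the linear and the constant coefficients of
    \<open>p(t + y1)\<close> and \<open>p(t + y2)\<close>.\<close>
  have E: "y1 + y1 = y2 + y2" "y1 * y1 + p1 * y1 = y2 * y2 + p1 * y2"
    using assms(7) by (auto simp: p pcompose_pCons algebra_simps)
  \<comment> \<open>Chosen so that \<open>p(t + y1) = t * t - l * t + m\<close>; the roots of
    \<open>q(t + y1)\<close> are \<open>0\<close> and \<open>d\<close>.\<close>
  define l m d where "l = - (p1 + y1 + y1)" and "m = y1 * y1 + p1 * y1 + p0" and "d = y2 - y1"
  have irr: "e * e - l * e + m \<noteq> 0" for e
  proof
    assume "e * e - l * e + m = 0"
    then have "poly p (e + y1) = 0" by (simp add: p l_def m_def algebra_simps)
    then obtain g where g: "p = [:- (e + y1), 1:] * g" by (auto simp: poly_eq_0_iff_dvd elim: dvdE)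
    then have "g \<noteq> 0" using p by auto
    then have "Polynomial.degree p = 1 + Polynomial.degree g"
      unfolding g by (subst degree_mult_eq) auto
    then have "Polynomial.degree g = 1" using assms(2) by simp
    moreover have "is_unit [:- (e + y1), 1:] \<or> is_unit g"
      using assms(5) g by (rule Factorial_Ring.irreducibleD)
    ultimately show False by (auto simp: is_unit_iff_degree \<open>g \<noteq> 0\<close>)
  qed
  have ev: "e * e - to_ac l * e + to_ac m = 0" if e: "eigenvalue_ac scale v e" for e
  proof -
    obtain x y where xy: "e = x - y" "x \<in> Root p" "y \<in> Root q"
      using assms(10) e by (auto simp: exceptional_def)
    have x: "x * x + to_ac p1 * x + to_ac p0 = 0"
      using xy(2) by (simp add: Root_def p to_ac_poly.base.map_poly_pCons_hom algebra_simps)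
    have "(y - to_ac y1) * (y - to_ac y2) = 0"
      using xy(3) by (simp add: Root_def assms(6) to_ac_poly.base.map_poly_pCons_hom algebra_simps)
    then consider "y = to_ac y1" | "y = to_ac y2" by auto
    then show ?thesis
    proof cases
      case 1
      then show ?thesis using x unfolding xy l_def m_def by (simp add: algebra_simps)
    next
      case 2
      \<comment> \<open>The two translates of \<open>p\<close> agree, so \<open>l\<close> and
        \<open>m\<close> can be rewritten with \<open>y2\<close>, and \<open>e = x - y2\<close> is
        again a root.\<close>
      have "l = - (p1 + y2 + y2)" "m = y2 * y2 + p1 * y2 + p0"
        using E by (simp_all add: l_def m_def add.assoc)
      then show ?thesis using x unfolding xy 2 by (simp only: to_ac_minus to_ac_add to_ac_mult) (simp add: algebra_simps)
    qed
  qed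
  have d: "d = 0 \<or> d = l \<and> (1::'a) + 1 = 0"
  proof (cases "d = 0")
    case False
    \<comment> \<open>The two equations in \<open>E\<close> become \<open>2 d = 0\<close> and
      \<open>d * (d - l) = 0\<close>.\<close>
    have "(1 + 1) * d = (y2 + y2) - (y1 + y1)" by (simp add: d_def algebra_simps)
    then have "(1 + 1) * d = 0" by (simp only: E(1) diff_self)
    moreover have "d * (y1 + y2 + p1) = 0" using E(2) by (simp add: d_def algebra_simps)
    ultimately have "(1::'a) + 1 = 0" "y1 + y2 + p1 = 0" using False by auto
    moreover have "d - l = y1 + y2 + p1" by (simp add: d_def l_def)
    ultimately show ?thesis by simp
  qed simp
  obtain n where "\<And>x. (poly_endo scale [:m, - l, 1:] v ^^ n) x = 0"
    using nilpotent_of_eigenvalues[OF assms(9) ev irr] by blast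
  then obtain w1 w2 where w: "Vector_Spaces.linear scale scale w1" "Vector_Spaces.linear scale scale w2"
    "\<And>x. v x = w1 x - w2 x" "\<And>x. w1 (w1 x) = scale l (w1 x) - scale m x" "\<And>x. w2 (w2 x) = scale d (w2 x)"
    using quadratic_difference[OF assms(9) irr _ d] by blast
  interpret w1: Vector_Spaces.linear scale scale w1 by fact
  interpret w2: Vector_Spaces.linear scale scale w2 by fact
  \<comment> \<open>Adding the same scalar to both leaves their difference unchanged and undoes the
    translation of the polynomials.\<close>
  define u1 u2 where "u1 x = w1 x + scale y1 x" and "u2 x = w2 x + scale y1 x" for x
  have u: "Vector_Spaces.linear scale scale u1" "Vector_Spaces.linear scale scale u2"
    unfolding u1_def u2_def
    by (unfold_locales; simp add: w1.add w2.add w1.scale w2.scale scale_right_distrib mult.commute)+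
  interpret u1: Vector_Spaces.linear scale scale u1 by (rule u)
  interpret u2: Vector_Spaces.linear scale scale u2 by (rule u)
  have "poly_endo scale p u1 x = 0" for x
  proof -
    have "poly_endo scale p u1 x = scale p0 x + scale p1 (u1 x) + u1 (u1 x)"
      by (simp add: p poly_endo_pCons[OF u(1)] u1.zero u1.add u1.scale add.assoc)
    also have "\<dots> = scale (p0 + p1 * y1 + y1 * y1 - m) x
        + (scale p1 (w1 x) + scale y1 (w1 x) + scale y1 (w1 x) + scale l (w1 x))"
      by (simp add: u1_def w1.add w1.scale w(4) scale_right_distrib scale_left_distrib scale_left_diff_distrib)
    also have "\<dots> = scale (p0 + p1 * y1 + y1 * y1 - m) x + scale (p1 + y1 + y1 + l) (w1 x)"
      by (simp only: scale_left_distrib)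
    also have "\<dots> = 0" by (simp add: l_def m_def)
    finally show ?thesis .
  qed
  moreover have "poly_endo scale q u2 x = 0" for x
  proof -
    have lin: "poly_endo scale [:- y, 1:] u2 x = u2 x - scale y x" for y x
      by (simp add: poly_endo_pCons[OF u(2)] u2.zero)
    \<comment> \<open>Here \<open>u2 - y2 = w2 - d\<close> and \<open>u2 - y1 = w2\<close>, so the
      product is \<open>w2 (w2 - d) = 0\<close>.\<close>
    have "poly_endo scale q u2 x = u2 (u2 x - scale y2 x) - scale y1 (u2 x - scale y2 x)"
      unfolding assms(6) poly_endo_mult[OF u(2)] lin ..
    also have "u2 x - scale y2 x = w2 x - scale d x"
      by (simp add: u2_def d_def scale_left_diff_distrib)
    also have "u2 (w2 x - scale d x) - scale y1 (w2 x - scale d x) = w2 (w2 x - scale d x)"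
      by (simp add: u2_def)
    also have "\<dots> = 0" by (simp add: w2.diff w2.scale w(5))
    finally show ?thesis .
  qed
  moreover have "v x = u1 x - u2 x" for x by (simp add: w(3) u1_def u2_def)
  ultimately show ?thesis using symplectic_difference_extension[OF u] by blast
qed

end
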